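(* Let $R$ be a commutative noetherian ring, let $\mathfrak{a}$ be a proper ideal of $R$, let $X$ be a non-zero $R$-module (not necessarily finitely generated), let $n$ be a positive integer, and let $x_1,\dots,x_n\in R$ be such that $\mathrm{cd}(\mathfrak{a}+(x_1,\dots,x_n),X)=\mathrm{cd}(\mathfrak{a},X)+n$. Then $\dim_R\bigl(H^{\mathrm{cd}(\mathfrak{a},X)}_{\mathfrak{a}}(X)\bigr)\geq n$. In particular, $H^{\mathrm{cd}(\mathfrak{a},X)}_{\mathfrak{a}}(X)$ is not artinian.
   Context: $H^i_{\mathfrak{a}}$ denotes the $i$th local cohomology functor, i.e. the $i$th right derived functor of the $\mathfrak{a}$-torsion functor $\Gamma_{\mathfrak{a}}$. For an ideal $\mathfrak{a}$ of $R$ and an $R$-module $X$, $\mathrm{cd}(\mathfrak{a},X):=\sup\{i : H^i_{\mathfrak{a}}(X)\neq 0\}$, the supremum being taken in the non-negative integers, so that $\mathrm{cd}(\mathfrak{a},X)=0$ if all $H^i_{\mathfrak{a}}(X)$ vanish. For a (not necessarily finitely generated) $R$-module $Y$, $\dim_R(Y)$ is the dimension of its support, i.e. the supremum of lengths of chains of prime ideals in $\mathrm{Supp}_R(Y)$ (possibly infinite). *)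

theory Defs
  imports "HOL-Algebra.Ring_Divisibility" "HOL-Algebra.Ideal_Product" "HOL-Library.Extended_Nat"
begin

section \<open>Module homomorphisms and quotient modules\<close>

definition mod_hom ::
    "('a, 'r) ring_scheme \<Rightarrow> ('a, 'b, 'm) module_scheme \<Rightarrow> ('a, 'c, 'k) module_scheme \<Rightarrow> ('b \<Rightarrow> 'c) set"
  where "mod_hom R M N = {h \<in> carrier M \<rightarrow> carrier N.
     (\<forall>x\<in>carrier M. \<forall>y\<in>carrier M. h (x \<oplus>\<^bsub>M\<^esub> y) = h x \<oplus>\<^bsub>N\<^esub> h y) \<and>
     (\<forall>r\<in>carrier R. \<forall>x\<in>carrier M. h (r \<odot>\<^bsub>M\<^esub> x) = r \<odot>\<^bsub>N\<^esub> h x)}"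

text \<open>The record type of modules extends that of rings; the fields \<open>mult\<close> and \<open>one\<close> play no
  role in a module.\<close>

definition quotient_module ::
    "('a, 'b, 'm) module_scheme \<Rightarrow> 'b set \<Rightarrow> ('a, 'b set) module"
  where "quotient_module M N =
    \<lparr>carrier = a_rcosets\<^bsub>M\<^esub> N, monoid.mult = undefined, monoid.one = undefined,
     ring.zero = N, ring.add = set_add M,
     smult = (\<lambda>r C. \<Union>m\<in>C. N +>\<^bsub>M\<^esub> (r \<odot>\<^bsub>M\<^esub> m))\<rparr>"


section \<open>Injective modules and injective resolutions\<close>

text \<open>A definition in HOL cannot quantify over the types of the test modules \<open>A\<close> and \<open>B\<close>. They
  range over all modules whose elements are of the type of the elements of \<open>R\<close>. This is no
  restriction: the lemma \<open>injective_module_extend\<close> below gives the extension property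
  for test modules over arbitrary types.\<close>

definition injective_module ::
    "('a, 'r) ring_scheme \<Rightarrow> ('a, 'c, 'k) module_scheme \<Rightarrow> bool"
  where "injective_module R E \<longleftrightarrow> module R E \<and>
    (\<forall>(A :: ('a, 'a) module) (B :: ('a, 'a) module) f h.
       module R A \<and> module R B \<and> f \<in> mod_hom R A B \<and> inj_on f (carrier A) \<and> h \<in> mod_hom R A E
       \<longrightarrow> (\<exists>g\<in>mod_hom R B E. \<forall>x\<in>carrier A. g (f x) = h x))"

text \<open>A partial extension of \<open>h\<close> along \<open>f\<close>, given by its graph.\<close>

definition partial_extension where
  "partial_extension R A B E f h G \<longleftrightarrow>
     G \<subseteq> carrier B \<times> carrier E \<and>
     (\<forall>x\<in>carrier A. (f x, h x) \<in> G) \<and>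
     (\<forall>b e b' e'. (b, e) \<in> G \<longrightarrow> (b', e') \<in> G \<longrightarrow> (b \<oplus>\<^bsub>B\<^esub> b', e \<oplus>\<^bsub>E\<^esub> e') \<in> G) \<and>
     (\<forall>r\<in>carrier R. \<forall>b e. (b, e) \<in> G \<longrightarrow> (r \<odot>\<^bsub>B\<^esub> b, r \<odot>\<^bsub>E\<^esub> e) \<in> G) \<and>
     (\<forall>e. (\<zero>\<^bsub>B\<^esub>, e) \<in> G \<longrightarrow> e = \<zero>\<^bsub>E\<^esub>)"

lemma partial_extensionD:
  assumes "partial_extension R A B E f h G"
  shows "(b, e) \<in> G \<Longrightarrow> b \<in> carrier B"
    and "(b, e) \<in> G \<Longrightarrow> e \<in> carrier E"
    and "x \<in> carrier A \<Longrightarrow> (f x, h x) \<in> G"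
    and "(b, e) \<in> G \<Longrightarrow> (b', e') \<in> G \<Longrightarrow> (b \<oplus>\<^bsub>B\<^esub> b', e \<oplus>\<^bsub>E\<^esub> e') \<in> G"
    and "r \<in> carrier R \<Longrightarrow> (b, e) \<in> G \<Longrightarrow> (r \<odot>\<^bsub>B\<^esub> b, r \<odot>\<^bsub>E\<^esub> e) \<in> G"
    and "(\<zero>\<^bsub>B\<^esub>, e) \<in> G \<Longrightarrow> e = \<zero>\<^bsub>E\<^esub>"
  using assms unfolding partial_extension_def by blast+

lemma mod_homD:
  assumes "h \<in> mod_hom R M N"
  shows "x \<in> carrier M \<Longrightarrow> h x \<in> carrier N"
    and "x \<in> carrier M \<Longrightarrow> y \<in> carrier M \<Longrightarrow> h (x \<oplus>\<^bsub>M\<^esub> y) = h x \<oplus>\<^bsub>N\<^esub> h y"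
    and "r \<in> carrier R \<Longrightarrow> x \<in> carrier M \<Longrightarrow> h (r \<odot>\<^bsub>M\<^esub> x) = r \<odot>\<^bsub>N\<^esub> h x"
  using assms unfolding mod_hom_def by auto

lemma mod_hom_zero:
  assumes "module R M" "module R N" "h \<in> mod_hom R M N"
  shows "h \<zero>\<^bsub>M\<^esub> = \<zero>\<^bsub>N\<^esub>"
proof -
  interpret M: module R M by fact
  interpret N: module R N by fact
  have "h (\<zero>\<^bsub>R\<^esub> \<odot>\<^bsub>M\<^esub> \<zero>\<^bsub>M\<^esub>) = \<zero>\<^bsub>R\<^esub> \<odot>\<^bsub>N\<^esub> h \<zero>\<^bsub>M\<^esub>"
    using mod_homD(3)[OF assms(3) M.R.zero_closed M.M.zero_closed] .
  then show ?thesis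
    using mod_homD(1)[OF assms(3), of "\<zero>\<^bsub>M\<^esub>"] by simp
qed

lemma partial_extension_unique:
  assumes "module R B" "module R E" "partial_extension R A B E f h G"
    and "(b, e) \<in> G" "(b, e') \<in> G"
  shows "e = e'"
proof -
  interpret B: module R B by fact
  interpret E: module R E by fact
  note D = partial_extensionD[OF assms(3)]
  have c: "b \<in> carrier B" "e \<in> carrier E" "e' \<in> carrier E"
    using D(1,2) assms(4,5) by auto
  have "((\<ominus>\<^bsub>R\<^esub> \<one>\<^bsub>R\<^esub>) \<odot>\<^bsub>B\<^esub> b, (\<ominus>\<^bsub>R\<^esub> \<one>\<^bsub>R\<^esub>) \<odot>\<^bsub>E\<^esub> e') \<in> G"
    using D(5)[OF _ assms(5)] by simp
  then have "(\<ominus>\<^bsub>B\<^esub> b, \<ominus>\<^bsub>E\<^esub> e') \<in> G"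
    using c by (simp add: B.smult_l_minus E.smult_l_minus)
  from D(4)[OF assms(4) this] have "(\<zero>\<^bsub>B\<^esub>, e \<oplus>\<^bsub>E\<^esub> \<ominus>\<^bsub>E\<^esub> e') \<in> G"
    using c by (simp add: B.M.r_neg)
  from D(6)[OF this] show ?thesis
    using c by (metis E.M.minus_equality E.M.minus_minus E.M.a_inv_closed E.M.add.m_comm)
qed

definition ring_as_module :: "('a, 'r) ring_scheme \<Rightarrow> ('a, 'a) module"
  where "ring_as_module R =
    \<lparr>carrier = carrier R, monoid.mult = monoid.mult R, monoid.one = monoid.one R,
     ring.zero = ring.zero R, ring.add = ring.add R, smult = monoid.mult R\<rparr>"

lemma module_ring_as_module:
  assumes "cring R"
  shows "module R (ring_as_module R)"
proof -
  interpret cring R by fact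
  have "abelian_group (ring_as_module R)"
  proof (rule abelian_groupI)
    fix x assume "x \<in> carrier (ring_as_module R)"
    then show "\<exists>y\<in>carrier (ring_as_module R).
        y \<oplus>\<^bsub>ring_as_module R\<^esub> x = \<zero>\<^bsub>ring_as_module R\<^esub>"
      by (auto simp: ring_as_module_def intro!: bexI[of _ "\<ominus>\<^bsub>R\<^esub> x"] l_neg)
  qed (auto simp: ring_as_module_def a_ac)
  then show ?thesis
    by (intro moduleI)
       (auto simp: ring_as_module_def l_distr r_distr m_assoc assms)
qed

lemma partial_extension_step:
  assumes E: "injective_module R E" and B: "module R B"
    and G: "partial_extension R A B E f h G" and b0: "b0 \<in> carrier B"
  shows "\<exists>G'. partial_extension R A B E f h G' \<and> G \<subseteq> G' \<and> (\<exists>e. (b0, e) \<in> G')"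
proof (cases "G = {}")
  case True
  have mE: "module R E" using E unfolding injective_module_def by blast
  interpret B: module R B by fact
  interpret E: module R E by fact
  let ?G = "carrier B \<times> {\<zero>\<^bsub>E\<^esub>}"
  have "carrier A = {}" using partial_extensionD(3)[OF G] True by auto
  then have "partial_extension R A B E f h ?G"
    unfolding partial_extension_def by auto
  then show ?thesis using True b0 by blast
next
  case False
  have mE: "module R E" using E unfolding injective_module_def by blast
  interpret B: module R B by fact
  interpret E: module R E by fact
  note D = partial_extensionD[OF G]
  note U = partial_extension_unique[OF B mE G]
  obtain b1 e1 where "(b1, e1) \<in> G" using False by auto
  from D(5)[OF B.R.zero_closed this] D(1,2)[OF this]
  have zeroG: "(\<zero>\<^bsub>B\<^esub>, \<zero>\<^bsub>E\<^esub>) \<in> G" by simp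
  define I where "I = {r \<in> carrier R. \<exists>e. (r \<odot>\<^bsub>B\<^esub> b0, e) \<in> G}"
  define k where "k = (\<lambda>r. THE e. (r \<odot>\<^bsub>B\<^esub> b0, e) \<in> G)"
  have k_eq: "k r = e" if "(r \<odot>\<^bsub>B\<^esub> b0, e) \<in> G" for r e
    unfolding k_def using that U by blast
  have kG: "(r \<odot>\<^bsub>B\<^esub> b0, k r) \<in> G" if "r \<in> I" for r
    using that k_eq unfolding I_def by auto
  let ?RM = "ring_as_module R"
  let ?I = "?RM\<lparr>carrier := I\<rparr>"
  interpret RM: module R ?RM using module_ring_as_module[OF B.R.is_cring] .
  have mult_in: "s \<otimes>\<^bsub>R\<^esub> r \<in> I" if "s \<in> carrier R" "r \<in> I" for r s
    using D(5)[OF that(1) kG[OF that(2)]] that b0 unfolding I_def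
    by (auto simp: B.smult_assoc1)
  have add_in: "r \<oplus>\<^bsub>R\<^esub> s \<in> I" if "r \<in> I" "s \<in> I" for r s
    using D(4)[OF kG[OF that(1)] kG[OF that(2)]] that b0 unfolding I_def
    by (auto simp: B.smult_l_distr)
  have IR: "r \<in> carrier R" if "r \<in> I" for r using that unfolding I_def by simp
  have sub: "submodule I R ?RM"
  proof (rule RM.submoduleI)
    show "I \<subseteq> carrier ?RM" using IR by (auto simp: ring_as_module_def)
    show "\<zero>\<^bsub>?RM\<^esub> \<in> I" using zeroG b0 unfolding I_def by (auto simp: ring_as_module_def)
    fix a assume a: "a \<in> I"
    have "\<ominus>\<^bsub>?RM\<^esub> a = \<ominus>\<^bsub>R\<^esub> a"
      by (simp add: a_inv_def m_inv_def ring_as_module_def)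
    also have "\<dots> = (\<ominus>\<^bsub>R\<^esub> \<one>\<^bsub>R\<^esub>) \<otimes>\<^bsub>R\<^esub> a"
      using IR[OF a] by (simp add: B.R.l_minus)
    also have "\<dots> \<in> I" using mult_in[OF _ a] by simp
    finally show "\<ominus>\<^bsub>?RM\<^esub> a \<in> I" .
  qed (auto simp: ring_as_module_def mult_in add_in)
  have mI: "module R ?I"
    using submodule.submodule_is_module[OF sub RM.module_axioms] .
  have incl: "(\<lambda>r. r) \<in> mod_hom R ?I ?RM"
    using IR unfolding mod_hom_def by (auto simp: ring_as_module_def)
  have k_hom: "k \<in> mod_hom R ?I E"
    unfolding mod_hom_def
  proof (clarsimp, intro conjI ballI)
    show "k \<in> I \<rightarrow> carrier E" using D(2)[OF kG] by auto
  next
    fix r s assume rs: "r \<in> I" "s \<in> I"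
    have "((r \<oplus>\<^bsub>R\<^esub> s) \<odot>\<^bsub>B\<^esub> b0, k r \<oplus>\<^bsub>E\<^esub> k s) \<in> G"
      using D(4)[OF kG[OF rs(1)] kG[OF rs(2)]] IR rs b0 by (simp add: B.smult_l_distr)
    then show "k (r \<oplus>\<^bsub>?RM\<^esub> s) = k r \<oplus>\<^bsub>E\<^esub> k s"
      using k_eq by (simp add: ring_as_module_def)
  next
    fix r s assume rs: "r \<in> carrier R" "s \<in> I"
    have "((r \<otimes>\<^bsub>R\<^esub> s) \<odot>\<^bsub>B\<^esub> b0, r \<odot>\<^bsub>E\<^esub> k s) \<in> G"
      using D(5)[OF rs(1) kG[OF rs(2)]] IR rs b0 by (simp add: B.smult_assoc1)
    then show "k (r \<odot>\<^bsub>?RM\<^esub> s) = r \<odot>\<^bsub>E\<^esub> k s"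
      using k_eq by (simp add: ring_as_module_def)
  qed
  obtain g where g: "g \<in> mod_hom R ?RM E" "\<forall>r\<in>I. g r = k r"
  proof -
    have "inj_on (\<lambda>r. r) (carrier ?I)" by simp
    with E mI RM.module_axioms incl k_hom
    have "\<exists>g\<in>mod_hom R ?RM E. \<forall>x\<in>carrier ?I. g x = k x"
      unfolding injective_module_def by blast
    then show ?thesis using that by auto
  qed
  define e0 where "e0 = g \<one>\<^bsub>R\<^esub>"
  have e0: "e0 \<in> carrier E"
    using mod_homD(1)[OF g(1), of "\<one>\<^bsub>R\<^esub>"] unfolding e0_def by (simp add: ring_as_module_def)
  have g_e0: "g r = r \<odot>\<^bsub>E\<^esub> e0" if "r \<in> carrier R" for r
    using mod_homD(3)[OF g(1) that, of "\<one>\<^bsub>R\<^esub>"] that unfolding e0_def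
    by (simp add: ring_as_module_def)
  define G' where
    "G' = {(b \<oplus>\<^bsub>B\<^esub> r \<odot>\<^bsub>B\<^esub> b0, e \<oplus>\<^bsub>E\<^esub> r \<odot>\<^bsub>E\<^esub> e0) | b e r. (b, e) \<in> G \<and> r \<in> carrier R}"
  have G'I: "(b', e') \<in> G'"
    if "(b, e) \<in> G" "r \<in> carrier R" "b' = b \<oplus>\<^bsub>B\<^esub> r \<odot>\<^bsub>B\<^esub> b0" "e' = e \<oplus>\<^bsub>E\<^esub> r \<odot>\<^bsub>E\<^esub> e0"
    for b e r b' e'
    unfolding G'_def using that by blast
  have GG': "G \<subseteq> G'"
  proof (rule subrelI)
    fix b e assume be: "(b, e) \<in> G"
    show "(b, e) \<in> G'"
      by (rule G'I[OF be, of "\<zero>\<^bsub>R\<^esub>"]) (use D(1,2)[OF be] b0 e0 in auto)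
  qed
  have b0G': "(b0, e0) \<in> G'"
    by (rule G'I[OF zeroG, of "\<one>\<^bsub>R\<^esub>"]) (use b0 e0 in auto)
  have "partial_extension R A B E f h G'"
    unfolding partial_extension_def
  proof (intro conjI allI ballI impI)
    show "G' \<subseteq> carrier B \<times> carrier E"
      using D(1,2) b0 e0 unfolding G'_def by auto
  next
    fix x assume "x \<in> carrier A"
    then show "(f x, h x) \<in> G'" using D(3) GG' by auto
  next
    fix b e b' e' assume 1: "(b, e) \<in> G'" and 2: "(b', e') \<in> G'"
    from 1 obtain c u r where c: "(c, u) \<in> G" "r \<in> carrier R"
      "b = c \<oplus>\<^bsub>B\<^esub> r \<odot>\<^bsub>B\<^esub> b0" "e = u \<oplus>\<^bsub>E\<^esub> r \<odot>\<^bsub>E\<^esub> e0" unfolding G'_def by blast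
    from 2 obtain c' u' r' where c': "(c', u') \<in> G" "r' \<in> carrier R"
      "b' = c' \<oplus>\<^bsub>B\<^esub> r' \<odot>\<^bsub>B\<^esub> b0" "e' = u' \<oplus>\<^bsub>E\<^esub> r' \<odot>\<^bsub>E\<^esub> e0" unfolding G'_def by blast
    note cl = D(1,2)[OF c(1)] D(1,2)[OF c'(1)]
    show "(b \<oplus>\<^bsub>B\<^esub> b', e \<oplus>\<^bsub>E\<^esub> e') \<in> G'"
    proof (rule G'I[OF D(4)[OF c(1) c'(1)], of "r \<oplus>\<^bsub>R\<^esub> r'"])
      show "b \<oplus>\<^bsub>B\<^esub> b' = c \<oplus>\<^bsub>B\<^esub> c' \<oplus>\<^bsub>B\<^esub> (r \<oplus>\<^bsub>R\<^esub> r') \<odot>\<^bsub>B\<^esub> b0"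
        using cl c c' b0 by (simp add: B.smult_l_distr B.M.a_ac)
      show "e \<oplus>\<^bsub>E\<^esub> e' = u \<oplus>\<^bsub>E\<^esub> u' \<oplus>\<^bsub>E\<^esub> (r \<oplus>\<^bsub>R\<^esub> r') \<odot>\<^bsub>E\<^esub> e0"
        using cl c c' e0 by (simp add: E.smult_l_distr E.M.a_ac)
    qed (use c c' in simp)
  next
    fix s b e assume s: "s \<in> carrier R" and 1: "(b, e) \<in> G'"
    from 1 obtain c u r where c: "(c, u) \<in> G" "r \<in> carrier R"
      "b = c \<oplus>\<^bsub>B\<^esub> r \<odot>\<^bsub>B\<^esub> b0" "e = u \<oplus>\<^bsub>E\<^esub> r \<odot>\<^bsub>E\<^esub> e0" unfolding G'_def by blast
    show "(s \<odot>\<^bsub>B\<^esub> b, s \<odot>\<^bsub>E\<^esub> e) \<in> G'"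
    proof (rule G'I[OF D(5)[OF s c(1)], of "s \<otimes>\<^bsub>R\<^esub> r"])
      show "s \<odot>\<^bsub>B\<^esub> b = s \<odot>\<^bsub>B\<^esub> c \<oplus>\<^bsub>B\<^esub> (s \<otimes>\<^bsub>R\<^esub> r) \<odot>\<^bsub>B\<^esub> b0"
        using D(1)[OF c(1)] c s b0 by (simp add: B.smult_r_distr B.smult_assoc1)
      show "s \<odot>\<^bsub>E\<^esub> e = s \<odot>\<^bsub>E\<^esub> u \<oplus>\<^bsub>E\<^esub> (s \<otimes>\<^bsub>R\<^esub> r) \<odot>\<^bsub>E\<^esub> e0"
        using D(2)[OF c(1)] c s e0 by (simp add: E.smult_r_distr E.smult_assoc1)
    qed (use c s in simp)
  next
    fix e assume "(\<zero>\<^bsub>B\<^esub>, e) \<in> G'"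
    then obtain c u r where c: "(c, u) \<in> G" "r \<in> carrier R"
      "\<zero>\<^bsub>B\<^esub> = c \<oplus>\<^bsub>B\<^esub> r \<odot>\<^bsub>B\<^esub> b0" "e = u \<oplus>\<^bsub>E\<^esub> r \<odot>\<^bsub>E\<^esub> e0" unfolding G'_def by blast
    note cl = D(1,2)[OF c(1)]
    have rb: "r \<odot>\<^bsub>B\<^esub> b0 = \<ominus>\<^bsub>B\<^esub> c"
      using c(2,3) cl b0 by (metis B.M.a_comm B.M.minus_equality B.smult_closed)
    have "((\<ominus>\<^bsub>R\<^esub> \<one>\<^bsub>R\<^esub>) \<odot>\<^bsub>B\<^esub> c, (\<ominus>\<^bsub>R\<^esub> \<one>\<^bsub>R\<^esub>) \<odot>\<^bsub>E\<^esub> u) \<in> G"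
      using D(5)[OF _ c(1)] by simp
    then have *: "(r \<odot>\<^bsub>B\<^esub> b0, \<ominus>\<^bsub>E\<^esub> u) \<in> G"
      using cl rb by (simp add: B.smult_l_minus E.smult_l_minus)
    then have "r \<in> I" using c(2) unfolding I_def by blast
    then have "r \<odot>\<^bsub>E\<^esub> e0 = \<ominus>\<^bsub>E\<^esub> u"
      using k_eq[OF *] g(2) g_e0[OF c(2)] by simp
    then show "e = \<zero>\<^bsub>E\<^esub>" using c(4) cl by (simp add: E.M.r_neg)
  qed
  then show ?thesis using GG' b0G' by blast
qed

lemma injective_module_extend:
  fixes A :: "('a, 'u, 'm) module_scheme" and B :: "('a, 'v, 'k) module_scheme"
  assumes E: "injective_module R E" and A: "module R A" and B: "module R B"
    and f: "f \<in> mod_hom R A B" "inj_on f (carrier A)" and h: "h \<in> mod_hom R A E"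
  shows "\<exists>g\<in>mod_hom R B E. \<forall>x\<in>carrier A. g (f x) = h x"
proof -
  have mE: "module R E" using E unfolding injective_module_def by blast
  interpret A: module R A by fact
  interpret B: module R B by fact
  interpret E: module R E by fact
  let ?P = "{G. partial_extension R A B E f h G}"
  define G0 where "G0 = (\<lambda>x. (f x, h x)) ` carrier A"
  have G0: "G0 \<in> ?P"
  proof -
    have "partial_extension R A B E f h G0"
      unfolding partial_extension_def
    proof (intro conjI allI ballI impI)
      show "G0 \<subseteq> carrier B \<times> carrier E"
        using mod_homD(1)[OF f(1)] mod_homD(1)[OF h] unfolding G0_def by auto
    next
      fix x assume "x \<in> carrier A"
      then show "(f x, h x) \<in> G0" unfolding G0_def by blast
    next
      fix b e b' e' assume "(b, e) \<in> G0" "(b', e') \<in> G0"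
      then obtain x y where "x \<in> carrier A" "y \<in> carrier A"
        "b = f x" "e = h x" "b' = f y" "e' = h y" unfolding G0_def by blast
      then show "(b \<oplus>\<^bsub>B\<^esub> b', e \<oplus>\<^bsub>E\<^esub> e') \<in> G0"
        unfolding G0_def
        by (intro image_eqI[of _ _ "x \<oplus>\<^bsub>A\<^esub> y"]) (simp_all add: mod_homD(2)[OF f(1)] mod_homD(2)[OF h])
    next
      fix r b e assume "r \<in> carrier R" "(b, e) \<in> G0"
      then obtain x where "x \<in> carrier A" "b = f x" "e = h x" unfolding G0_def by blast
      then show "(r \<odot>\<^bsub>B\<^esub> b, r \<odot>\<^bsub>E\<^esub> e) \<in> G0"
        unfolding G0_def using \<open>r \<in> carrier R\<close>
        by (intro image_eqI[of _ _ "r \<odot>\<^bsub>A\<^esub> x"]) (simp_all add: mod_homD(3)[OF f(1)] mod_homD(3)[OF h])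
    next
      fix e assume "(\<zero>\<^bsub>B\<^esub>, e) \<in> G0"
      then obtain x where x: "x \<in> carrier A" "f x = \<zero>\<^bsub>B\<^esub>" "e = h x" unfolding G0_def by force
      then have "x = \<zero>\<^bsub>A\<^esub>"
        using inj_onD[OF f(2), of x "\<zero>\<^bsub>A\<^esub>"] mod_hom_zero[OF A B f(1)] by simp
      then show "e = \<zero>\<^bsub>E\<^esub>" using x(3) mod_hom_zero[OF A mE h] by simp
    qed
    then show ?thesis by simp
  qed
  have "\<exists>G\<in>?P. \<forall>G'\<in>?P. G \<subseteq> G' \<longrightarrow> G' = G"
  proof (rule subset_Zorn_nonempty)
    show "?P \<noteq> {}" using G0 by blast
  next
    fix \<C> assume ne: "\<C> \<noteq> {}" and ch: "subset.chain ?P \<C>"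
    have P: "partial_extension R A B E f h G" if "G \<in> \<C>" for G
      using that ch unfolding subset.chain_def by blast
    have lin: "G \<subseteq> G' \<or> G' \<subseteq> G" if "G \<in> \<C>" "G' \<in> \<C>" for G G'
      using that ch unfolding subset_chain_def by blast
    have "partial_extension R A B E f h (\<Union>\<C>)"
      unfolding partial_extension_def
    proof (intro conjI allI ballI impI)
      show "\<Union>\<C> \<subseteq> carrier B \<times> carrier E"
        using P unfolding partial_extension_def by blast
    next
      fix x assume "x \<in> carrier A"
      then show "(f x, h x) \<in> \<Union>\<C>" using ne partial_extensionD(3)[OF P] by blast
    next
      fix b e b' e' assume "(b, e) \<in> \<Union>\<C>" "(b', e') \<in> \<Union>\<C>"
      then obtain G where "G \<in> \<C>" "(b, e) \<in> G" "(b', e') \<in> G" using lin by blast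
      then show "(b \<oplus>\<^bsub>B\<^esub> b', e \<oplus>\<^bsub>E\<^esub> e') \<in> \<Union>\<C>"
        using partial_extensionD(4)[OF P] by blast
    next
      fix r b e assume "r \<in> carrier R" "(b, e) \<in> \<Union>\<C>"
      then show "(r \<odot>\<^bsub>B\<^esub> b, r \<odot>\<^bsub>E\<^esub> e) \<in> \<Union>\<C>"
        using partial_extensionD(5)[OF P] by blast
    next
      fix e assume "(\<zero>\<^bsub>B\<^esub>, e) \<in> \<Union>\<C>"
      then show "e = \<zero>\<^bsub>E\<^esub>" using partial_extensionD(6)[OF P] by blast
    qed
    then show "\<Union>\<C> \<in> ?P" by simp
  qed
  then obtain G where G: "partial_extension R A B E f h G"
    and max: "\<And>G'. partial_extension R A B E f h G' \<Longrightarrow> G \<subseteq> G' \<Longrightarrow> G' = G"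
    by blast
  note D = partial_extensionD[OF G]
  have tot: "\<exists>e. (b, e) \<in> G" if "b \<in> carrier B" for b
    using partial_extension_step[OF E B G that] max by blast
  define g where "g = (\<lambda>b. THE e. (b, e) \<in> G)"
  have g_eq: "g b = e" if "(b, e) \<in> G" for b e
    unfolding g_def using that partial_extension_unique[OF B mE G] by blast
  have gG: "(b, g b) \<in> G" if "b \<in> carrier B" for b
    using tot[OF that] g_eq by auto
  have "g \<in> mod_hom R B E"
    unfolding mod_hom_def using D(2)[OF gG] g_eq D(4)[OF gG gG] D(5)[OF _ gG] by auto
  moreover have "\<forall>x\<in>carrier A. g (f x) = h x" using g_eq D(3) by blast
  ultimately show ?thesis by blast
qed

text \<open>\<open>0 \<rightarrow> X \<rightarrow> E 0 \<rightarrow> E 1 \<rightarrow> \<dots>\<close> is exact with augmentation \<open>\<epsilon>\<close> and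
  differentials \<open>d i\<close> from \<open>E i\<close> to \<open>E (Suc i)\<close>, and every \<open>E i\<close> is injective.\<close>

definition injective_resolution ::
    "('a, 'r) ring_scheme \<Rightarrow> ('a, 'b, 'm) module_scheme \<Rightarrow> ('b \<Rightarrow> 'c) \<Rightarrow>
     (nat \<Rightarrow> ('a, 'c) module) \<Rightarrow> (nat \<Rightarrow> 'c \<Rightarrow> 'c) \<Rightarrow> bool"
  where "injective_resolution R X \<epsilon> E d \<longleftrightarrow>
     (\<forall>i. injective_module R (E i)) \<and>
     \<epsilon> \<in> mod_hom R X (E 0) \<and> (\<forall>i. d i \<in> mod_hom R (E i) (E (Suc i))) \<and>
     inj_on \<epsilon> (carrier X) \<and>
     a_kernel (E 0) (E 1) (d 0) = \<epsilon> ` carrier X \<and>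
     (\<forall>i. a_kernel (E (Suc i)) (E (Suc (Suc i))) (d (Suc i)) = d i ` carrier (E i))"


section \<open>Local cohomology and cohomological dimension\<close>

fun ideal_power :: "('a, 'r) ring_scheme \<Rightarrow> 'a set \<Rightarrow> nat \<Rightarrow> 'a set"
  where
    "ideal_power R I 0 = carrier R"
  | "ideal_power R I (Suc k) = I \<cdot>\<^bsub>R\<^esub> ideal_power R I k"

definition torsion_functor ::
    "('a, 'r) ring_scheme \<Rightarrow> 'a set \<Rightarrow> ('a, 'b, 'm) module_scheme \<Rightarrow> ('a, 'b, 'm) module_scheme"
  where "torsion_functor R I M =
    M\<lparr>carrier := {m \<in> carrier M. \<exists>k. \<forall>r\<in>ideal_power R I k. r \<odot>\<^bsub>M\<^esub> m = \<zero>\<^bsub>M\<^esub>}\<rparr>"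

definition coboundaries ::
    "(nat \<Rightarrow> ('a, 'c, 'k) module_scheme) \<Rightarrow> (nat \<Rightarrow> 'c \<Rightarrow> 'c) \<Rightarrow> nat \<Rightarrow> 'c set"
  where "coboundaries C d i =
    (case i of 0 \<Rightarrow> {\<zero>\<^bsub>C 0\<^esub>} | Suc j \<Rightarrow> d j ` carrier (C j))"

definition cohomology ::
    "(nat \<Rightarrow> ('a, 'c, 'k) module_scheme) \<Rightarrow> (nat \<Rightarrow> 'c \<Rightarrow> 'c) \<Rightarrow> nat \<Rightarrow> ('a, 'c set) module"
  where "cohomology C d i =
    quotient_module ((C i)\<lparr>carrier := a_kernel (C i) (C (Suc i)) (d i)\<rparr>) (coboundaries C d i)"

text \<open>\<open>local_cohomology R I E d i\<close> is the \<open>i\<close>-th right derived functor of the \<open>I\<close>-torsion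
  functor at \<open>X\<close>, when \<open>(E, d)\<close> is an injective resolution of \<open>X\<close>. The torsion functor acts on
  the differentials by restriction. Different resolutions of \<open>X\<close> give isomorphic modules.\<close>

definition local_cohomology ::
    "('a, 'r) ring_scheme \<Rightarrow> 'a set \<Rightarrow> (nat \<Rightarrow> ('a, 'c) module) \<Rightarrow> (nat \<Rightarrow> 'c \<Rightarrow> 'c) \<Rightarrow>
     nat \<Rightarrow> ('a, 'c set) module"
  where "local_cohomology R I E d i = cohomology (\<lambda>j. torsion_functor R I (E j)) d i"

text \<open>The supremum of the empty set of natural numbers is \<open>0\<close>. Over a noetherian ring the set is
  bounded, since the cohomology vanishes above the number of generators of \<open>I\<close>.\<close>

definition cohom_dim ::
    "('a, 'r) ring_scheme \<Rightarrow> 'a set \<Rightarrow> (nat \<Rightarrow> ('a, 'c) module) \<Rightarrow> (nat \<Rightarrow> 'c \<Rightarrow> 'c) \<Rightarrow> nat"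
  where "cohom_dim R I E d =
    Sup {i. carrier (local_cohomology R I E d i) \<noteq> {\<zero>\<^bsub>local_cohomology R I E d i\<^esub>}}"


section \<open>Support, dimension and the artinian property\<close>

definition fraction_rel ::
    "('a, 'r) ring_scheme \<Rightarrow> 'a set \<Rightarrow> ('a, 'b, 'm) module_scheme \<Rightarrow> (('b \<times> 'a) \<times> ('b \<times> 'a)) set"
  where "fraction_rel R S M = {((m, s), (m', s')).
     m \<in> carrier M \<and> m' \<in> carrier M \<and> s \<in> S \<and> s' \<in> S \<and>
     (\<exists>u\<in>S. u \<odot>\<^bsub>M\<^esub> ((s' \<odot>\<^bsub>M\<^esub> m) \<ominus>\<^bsub>M\<^esub> (s \<odot>\<^bsub>M\<^esub> m')) = \<zero>\<^bsub>M\<^esub>)}"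

definition localization ::
    "('a, 'r) ring_scheme \<Rightarrow> 'a set \<Rightarrow> ('a, 'b, 'm) module_scheme \<Rightarrow> ('b \<times> 'a) set set"
  where "localization R S M = (carrier M \<times> S) // fraction_rel R S M"

definition localization_zero ::
    "('a, 'r) ring_scheme \<Rightarrow> 'a set \<Rightarrow> ('a, 'b, 'm) module_scheme \<Rightarrow> ('b \<times> 'a) set"
  where "localization_zero R S M = fraction_rel R S M `` {(\<zero>\<^bsub>M\<^esub>, \<one>\<^bsub>R\<^esub>)}"

definition module_support ::
    "('a, 'r) ring_scheme \<Rightarrow> ('a, 'b, 'm) module_scheme \<Rightarrow> 'a set set"
  where "module_support R M =
    {P. primeideal P R \<and>
        localization R (carrier R - P) M \<noteq> {localization_zero R (carrier R - P) M}}"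

text \<open>The zero module has empty support, and its dimension is \<open>0\<close> here, the supremum of the
  empty set in \<^typ>\<open>enat\<close>, rather than \<open>-\<infinity>\<close>.\<close>

definition module_dim ::
    "('a, 'r) ring_scheme \<Rightarrow> ('a, 'b, 'm) module_scheme \<Rightarrow> enat"
  where "module_dim R M =
    Sup {enat l | l. \<exists>p :: nat \<Rightarrow> 'a set.
           (\<forall>i\<le>l. p i \<in> module_support R M) \<and> (\<forall>i<l. p i \<subset> p (Suc i))}"

definition artinian_module ::
    "('a, 'r) ring_scheme \<Rightarrow> ('a, 'b, 'm) module_scheme \<Rightarrow> bool"
  where "artinian_module R M \<longleftrightarrow>
    (\<forall>N :: nat \<Rightarrow> 'b set. (\<forall>i. submodule (N i) R M) \<and> (\<forall>i. N (Suc i) \<subseteq> N i)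
       \<longrightarrow> (\<exists>k. \<forall>i\<ge>k. N i = N k))"

end

theory Submission
  imports Defs
begin

text \<open>Write \<open>\<Gamma>\<^sub>b\<close> for the \<open>b\<close>-torsion functor, so that \<open>H\<^sup>i\<^sub>b(X)\<close> is the cohomology of the complex
  \<open>\<Gamma>\<^sub>b(E)\<close>, and let \<open>x\<close> be an element of the ring. An element is torsion for \<open>b + (x)\<close> iff it is
  \<open>b\<close>-torsion and killed by a power of \<open>x\<close>. Moreover, since the \<open>E i\<close> are injective and \<open>R\<close> is
  noetherian, every \<open>\<Gamma>\<^sub>b(E i)\<close> maps onto its localization at the powers of \<open>x\<close>
  (\<open>injective_torsion_divisible\<close>). Hence the sequence of complexes
  \<open>0 \<rightarrow> \<Gamma>\<^bsub>b+(x)\<^esub>(E) \<rightarrow> \<Gamma>\<^sub>b(E) \<rightarrow> \<Gamma>\<^sub>b(E)\<^sub>x \<rightarrow> 0\<close> is exact.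

  Suppose that \<open>H\<^sup>i\<^sub>b(X)\<close> vanishes for all \<open>i > m\<close>. The long exact sequence then shows that
  \<open>H\<^sup>i\<^bsub>b+(x)\<^esub>(X)\<close> vanishes for \<open>i > m + 1\<close>, and that its component in degree \<open>m + 1\<close> is the cokernel
  of \<open>H\<^sup>m\<^sub>b(X) \<rightarrow> H\<^sup>m\<^sub>b(X)\<^sub>x\<close>. If a prime \<open>P\<close> lies in the support of that cokernel, then \<open>P\<close> contains
  \<open>x\<close>, because every element of the cokernel is killed by a power of \<open>x\<close>. On the other hand
  \<open>H\<^sup>m\<^sub>b(X)\<^sub>x\<close> does not vanish at \<open>P\<close>, so some prime \<open>Q\<close> inside \<open>P\<close> that avoids \<open>x\<close> lies in the support
  of \<open>H\<^sup>m\<^sub>b(X)\<close>; in particular \<open>Q\<close> is strictly smaller than \<open>P\<close>. This is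
  \<open>cohom_support_descend\<close>. The long exact sequence is not set up: the only part of it that matters
  is a computation with cocycles, \<open>cobound_adjoin\<close>.

  Adjoining \<open>x\<^sub>1, \<dots>, x\<^sub>n\<close> to \<open>\<aa>\<close> raises the cohomological dimension by \<open>n\<close>, so the module in degree
  \<open>cd + n\<close> has a prime in its support. Descending \<open>n\<close> times yields a chain of \<open>n + 1\<close> primes whose
  smallest member lies in the support of the top module for \<open>\<aa>\<close>. Supports are closed under passing
  to larger primes, so the whole chain lies there. For \<open>n > 0\<close> the module thus has a non-maximal
  prime in its support, which no artinian module has.

  The cohomological dimension is a supremum of natural numbers, informative only for bounded
  sets. Boundedness comes from the same descent: the resolution has no cohomology in positive
  degrees, which settles the zero ideal, and each further generator of \<open>b\<close> raises the bound by at most one.\<close>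

section \<open>Ideals\<close>

lemma (in noetherian_ring) ascending_ideals_stabilize:
  fixes J :: "nat \<Rightarrow> 'a set"
  assumes ideals: "\<And>k. ideal (J k) R" and mono: "\<And>k. J k \<subseteq> J (Suc k)"
  obtains l where "\<And>k. J (l + k) = J l"
proof -
  have le: "J k \<subseteq> J l" if "k \<le> l" for k l
    using lift_Suc_mono_le[of J, OF mono that] .
  have "subset.chain {I. ideal I R} (range J)"
  proof -
    have "J k \<subseteq> J l \<or> J l \<subseteq> J k" for k l
      using le[of k l] le[of l k] by linarith
    then show ?thesis
      unfolding subset_chain_def using ideals by blast
  qed
  then have "\<Union>(range J) \<in> range J"
    using ideal_chain_is_trivial[of "range J"] by blast
  then obtain l where l: "\<Union>(range J) = J l" by blast
  have "J (l + k) = J l" for k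
    using l le[of l "l + k"] by (metis UNIV_I UN_upper le_add1 subset_antisym)
  then show thesis using that by blast
qed

lemma (in ring) ideal_sum_upper:
  assumes "ideal I R" "ideal J R"
  shows "I \<subseteq> I <+>\<^bsub>R\<^esub> J" and "J \<subseteq> I <+>\<^bsub>R\<^esub> J"
proof -
  have "I \<union> J \<subseteq> I <+>\<^bsub>R\<^esub> J"
    unfolding union_genideal[OF assms, symmetric]
    by (rule genideal_self) (auto dest: ideal.Icarr[OF assms(1)] ideal.Icarr[OF assms(2)])
  then show "I \<subseteq> I <+>\<^bsub>R\<^esub> J" "J \<subseteq> I <+>\<^bsub>R\<^esub> J" by auto
qed

lemma (in ring) ideal_sum_least:
  assumes "ideal I R" "ideal J R" "ideal K R" "I \<subseteq> K" "J \<subseteq> K"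
  shows "I <+>\<^bsub>R\<^esub> J \<subseteq> K"
  unfolding union_genideal[OF assms(1,2), symmetric]
  by (rule genideal_minimal) (use assms in auto)

lemma (in ring) ideal_sum_genideal_empty:
  assumes I: "ideal I R"
  shows "I <+>\<^bsub>R\<^esub> Idl {} = I"
proof
  have e: "ideal (Idl {}) R" by (rule genideal_ideal) simp
  have "Idl {} \<subseteq> I" by (rule genideal_minimal[OF I]) simp
  then show "I <+>\<^bsub>R\<^esub> Idl {} \<subseteq> I" by (intro ideal_sum_least[OF I e I]) auto
  show "I \<subseteq> I <+>\<^bsub>R\<^esub> Idl {}" by (rule ideal_sum_upper[OF I e])
qed

lemma (in cring) ideal_sum_genideal_insert:
  assumes I: "ideal I R" and A: "A \<subseteq> carrier R" and a: "a \<in> carrier R"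
  shows "I <+>\<^bsub>R\<^esub> Idl (insert a A) = (I <+>\<^bsub>R\<^esub> Idl A) <+>\<^bsub>R\<^esub> PIdl a"
proof
  have aA: "insert a A \<subseteq> carrier R" using A a by blast
  note idA = genideal_ideal[OF A] and idaA = genideal_ideal[OF aA] and ida = cgenideal_ideal[OF a]
  note L = add_ideals[OF I idaA] and IA = add_ideals[OF I idA]
  note K = add_ideals[OF IA ida]
  note le = ideal_sum_upper[OF I idaA] ideal_sum_upper[OF I idA] ideal_sum_upper[OF IA ida]
  have "insert a A \<subseteq> (I <+>\<^bsub>R\<^esub> Idl A) <+>\<^bsub>R\<^esub> PIdl a"
    using le(4-6) genideal_self[OF A] cgenideal_self[OF a] by blast
  then show "I <+>\<^bsub>R\<^esub> Idl (insert a A) \<subseteq> (I <+>\<^bsub>R\<^esub> Idl A) <+>\<^bsub>R\<^esub> PIdl a"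
    using le(3,5) by (intro ideal_sum_least[OF I idaA K] genideal_minimal[OF K]) auto
  have "Idl A \<subseteq> Idl (insert a A)" "PIdl a \<subseteq> Idl (insert a A)"
    using genideal_self[OF aA] by (auto intro!: genideal_minimal[OF idaA] cgenideal_minimal[OF idaA] dest!: subsetD)
  then show "(I <+>\<^bsub>R\<^esub> Idl A) <+>\<^bsub>R\<^esub> PIdl a \<subseteq> I <+>\<^bsub>R\<^esub> Idl (insert a A)"
    using le(1,2) by (intro ideal_sum_least[OF IA ida L] ideal_sum_least[OF I idA L]) auto
qed

text \<open>Krull's lemma: an ideal that is maximal among those containing \<open>I\<close> and disjoint from \<open>S\<close> is prime.
  It is applied with \<open>S = {\<one>}\<close>, and with the products of powers of an element \<open>x\<close> with elements outside
  a given prime, where it produces a smaller prime that avoids \<open>x\<close>.\<close>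

lemma (in cring) prime_avoiding_multiplicative_set:
  assumes I: "ideal I R" and S: "S \<subseteq> carrier R" "\<one> \<in> S" "\<And>s t. s \<in> S \<Longrightarrow> t \<in> S \<Longrightarrow> s \<otimes> t \<in> S"
    and disj: "I \<inter> S = {}"
  obtains Q where "primeideal Q R" "I \<subseteq> Q" "Q \<inter> S = {}"
proof -
  let ?A = "{Q. ideal Q R \<and> I \<subseteq> Q \<and> Q \<inter> S = {}}"
  have "\<exists>Q\<in>?A. \<forall>J\<in>?A. Q \<subseteq> J \<longrightarrow> J = Q"
  proof (rule subset_Zorn_nonempty)
    show "?A \<noteq> {}" using I disj by blast
  next
    fix C assume C: "C \<noteq> {}" "subset.chain ?A C"
    then have "subset.chain {Q. ideal Q R} C"
      unfolding subset.chain_def by blast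
    from chain_Union_is_ideal[OF this] C(1) have "ideal (\<Union>C) R" by simp
    then show "\<Union>C \<in> ?A"
      using C unfolding subset.chain_def by blast
  qed
  then obtain Q where Q: "ideal Q R" "I \<subseteq> Q" "Q \<inter> S = {}"
    and max': "\<forall>J\<in>?A. Q \<subseteq> J \<longrightarrow> J = Q"
    by auto
  have max: "J = Q" if "ideal J R" "Q \<subseteq> J" "J \<inter> S = {}" for J
    using max' that Q(2) by auto
  interpret Q: ideal Q R by fact
  \<comment> \<open>By maximality of \<open>Q\<close>, the ideal generated by \<open>Q\<close> and an element outside \<open>Q\<close> meets \<open>S\<close>.\<close>
  have meets: "\<exists>q\<in>Q. \<exists>r\<in>carrier R. q \<oplus> r \<otimes> a \<in> S" if a: "a \<in> carrier R" "a \<notin> Q" for a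
  proof -
    have id: "ideal (Q <+>\<^bsub>R\<^esub> PIdl a) R"
      by (rule add_ideals[OF Q(1) cgenideal_ideal[OF a(1)]])
    note sup = ideal_sum_upper[OF Q(1) cgenideal_ideal[OF a(1)]]
    have "a \<in> Q <+>\<^bsub>R\<^esub> PIdl a" using sup(2) cgenideal_self[OF a(1)] by blast
    then have "(Q <+>\<^bsub>R\<^esub> PIdl a) \<inter> S \<noteq> {}" using max[OF id sup(1)] a(2) by blast
    then show ?thesis unfolding set_add_def' cgenideal_def by blast
  qed
  have "primeideal Q R"
  proof (rule primeidealI[OF Q(1) is_cring])
    show "carrier R \<noteq> Q" using Q(3) S(2) by auto
  next
    fix a b assume a: "a \<in> carrier R" and b: "b \<in> carrier R" and ab: "a \<otimes> b \<in> Q"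
    show "a \<in> Q \<or> b \<in> Q"
    proof (rule ccontr)
      assume "\<not> (a \<in> Q \<or> b \<in> Q)"
      with meets a b obtain q r q' r' where q: "q \<in> Q" "r \<in> carrier R" "q \<oplus> r \<otimes> a \<in> S"
        and q': "q' \<in> Q" "r' \<in> carrier R" "q' \<oplus> r' \<otimes> b \<in> S" by meson
      have c: "q \<in> carrier R" "q' \<in> carrier R" using q q' Q.Icarr by auto
      have "(q \<oplus> r \<otimes> a) \<otimes> (q' \<oplus> r' \<otimes> b)
          = (q' \<oplus> r' \<otimes> b) \<otimes> q \<oplus> ((r \<otimes> a) \<otimes> q' \<oplus> (r \<otimes> r') \<otimes> (a \<otimes> b))"
        using c q q' a b by (simp add: l_distr r_distr m_ac a_ac)
      also have "\<dots> \<in> Q"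
        using c q(2,3) q'(2,3) a b S(1)
        by (intro Q.a_closed Q.I_l_closed[OF q(1)] Q.I_l_closed[OF q'(1)] Q.I_l_closed[OF ab]) auto
      finally show False using S(3)[OF q(3) q'(3)] Q(3) by blast
    qed
  qed
  then show thesis using that Q by blast
qed

lemma (in ring) ideal_power_ideal:
  assumes "ideal I R"
  shows "ideal (ideal_power R I k) R"
  by (induction k) (auto simp: oneideal ideal_prod_is_ideal assms)

lemma (in ring) ideal_power_decreasing:
  assumes "ideal I R" "k \<le> l"
  shows "ideal_power R I l \<subseteq> ideal_power R I k"
  using assms(2)
proof (induction rule: dec_induct)
  case (step n)
  then show ?case
    using ideal_prod_inter[OF assms(1) ideal_power_ideal[OF assms(1), of n]] by auto
qed simp

lemma ideal_prod_mono:
  assumes "I \<subseteq> I'" "J \<subseteq> J'"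
  shows "I \<cdot>\<^bsub>R\<^esub> J \<subseteq> I' \<cdot>\<^bsub>R\<^esub> J'"
proof
  fix a assume "a \<in> I \<cdot>\<^bsub>R\<^esub> J"
  then show "a \<in> I' \<cdot>\<^bsub>R\<^esub> J'"
    using assms by induction (auto intro: ideal_prod.intros)
qed

lemma ideal_power_mono:
  assumes "I \<subseteq> J"
  shows "ideal_power R I k \<subseteq> ideal_power R J k"
  by (induction k) (auto dest: subsetD[OF ideal_prod_mono[OF assms]])

lemma (in cring) pow_mem_ideal_power:
  assumes "ideal I R" "a \<in> I"
  shows "a [^] k \<in> ideal_power R I k"
proof (induction k)
  case (Suc k)
  have "a \<in> carrier R" using ideal.Icarr[OF assms] .
  then have "a [^] Suc k = a \<otimes> a [^] k" by (simp add: m_comm)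
  then show ?case using ideal_prod.prod[OF assms(2) Suc] by simp
qed simp


section \<open>Modules\<close>

lemma (in module) submodule_criterion:
  assumes "H \<subseteq> carrier M" "\<zero>\<^bsub>M\<^esub> \<in> H" "\<And>a b. a \<in> H \<Longrightarrow> b \<in> H \<Longrightarrow> a \<oplus>\<^bsub>M\<^esub> b \<in> H"
    and "\<And>r a. r \<in> carrier R \<Longrightarrow> a \<in> H \<Longrightarrow> r \<odot>\<^bsub>M\<^esub> a \<in> H"
  shows "submodule H R M"
proof (rule submoduleI[OF assms(1,2)])
  fix a assume a: "a \<in> H"
  then have "\<ominus>\<^bsub>M\<^esub> a = (\<ominus>\<^bsub>R\<^esub> \<one>\<^bsub>R\<^esub>) \<odot>\<^bsub>M\<^esub> a"
    using assms(1) by (simp add: smult_l_minus subset_iff)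
  then show "\<ominus>\<^bsub>M\<^esub> a \<in> H" using assms(4)[OF _ a] by simp
qed (use assms in auto)

text \<open>For the submodule of coboundaries and a cocycle \<open>m\<close>, this ideal is the annihilator of the
  cohomology class of \<open>m\<close>. Stated in this way it can be used without passing to the quotient module.\<close>

lemma (in module) colon_ideal:
  assumes N: "submodule N R M" and m: "m \<in> carrier M"
  shows "ideal {r \<in> carrier R. r \<odot>\<^bsub>M\<^esub> m \<in> N} R"
proof (rule idealI)
  show "ring R" using R.ring_axioms .
  have z: "\<zero>\<^bsub>M\<^esub> \<in> N" using submoduleE(2,4)[OF N] submoduleE(1)[OF N]
    by (metis M.add.l_inv_ex M.zero_closed R.zero_closed all_not_in_conv smult_l_null subsetD)
  show "subgroup {r \<in> carrier R. r \<odot>\<^bsub>M\<^esub> m \<in> N} (add_monoid R)"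
    by (rule subgroup.intro)
      (use m z submoduleE[OF N] in \<open>auto simp: smult_l_distr smult_l_minus simp flip: a_inv_def\<close>)
next
  fix a r assume "a \<in> {r \<in> carrier R. r \<odot>\<^bsub>M\<^esub> m \<in> N}" "r \<in> carrier R"
  then show "r \<otimes> a \<in> {r \<in> carrier R. r \<odot>\<^bsub>M\<^esub> m \<in> N}" "a \<otimes> r \<in> {r \<in> carrier R. r \<odot>\<^bsub>M\<^esub> m \<in> N}"
    using m submoduleE(4)[OF N] by (auto simp: smult_assoc1 R.m_comm[of a r])
qed

lemma (in module) smult_commute:
  assumes "r \<in> carrier R" "s \<in> carrier R" "m \<in> carrier M"
  shows "r \<odot>\<^bsub>M\<^esub> (s \<odot>\<^bsub>M\<^esub> m) = s \<odot>\<^bsub>M\<^esub> (r \<odot>\<^bsub>M\<^esub> m)"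
  using assms by (simp add: smult_assoc1[symmetric] R.m_comm)

lemma (in module) smult_pow_add:
  assumes "x \<in> carrier R" "m \<in> carrier M"
  shows "x [^] (k + l :: nat) \<odot>\<^bsub>M\<^esub> m = x [^] k \<odot>\<^bsub>M\<^esub> (x [^] l \<odot>\<^bsub>M\<^esub> m)"
  using assms by (simp add: R.nat_pow_mult[symmetric] smult_assoc1)

lemma (in module) ideal_prod_annihilates:
  assumes "ideal I R" "ideal J R" "m \<in> carrier M"
    and "\<And>i j. i \<in> I \<Longrightarrow> j \<in> J \<Longrightarrow> j \<odot>\<^bsub>M\<^esub> (i \<odot>\<^bsub>M\<^esub> m) = \<zero>\<^bsub>M\<^esub>" and "r \<in> I \<cdot> J"
  shows "r \<odot>\<^bsub>M\<^esub> m = \<zero>\<^bsub>M\<^esub>"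
  using assms(5)
proof induction
  case (prod i j)
  then show ?case
    using assms by (simp add: smult_assoc1 smult_commute[of i j] ideal.Icarr)
next
  case (sum s t)
  then have "s \<in> carrier R" "t \<in> carrier R"
    using R.ideal_prod_in_carrier[OF assms(1,2)] by auto
  then show ?case using sum assms(3) by (simp add: smult_l_distr)
qed

text \<open>Every product of \<open>p + q\<close> elements of \<open>I + (x)\<close> expands into terms with \<open>p\<close> factors from \<open>I\<close> or
  \<open>q\<close> factors \<open>x\<close>. The induction avoids the expansion: if \<open>u \<oplus> c \<otimes> x\<close> is one factor, then
  \<open>u \<odot> m\<close> satisfies the hypothesis for \<open>p - 1\<close> and \<open>q\<close>, and \<open>x \<odot> m\<close> satisfies it for \<open>p\<close> and \<open>q - 1\<close>.\<close>

lemma (in module) adjoin_ideal_power_annihilates: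
  assumes I: "ideal I R" and x: "x \<in> carrier R" and m: "m \<in> carrier M"
    and "\<And>r. r \<in> ideal_power R I p \<Longrightarrow> r \<odot>\<^bsub>M\<^esub> m = \<zero>\<^bsub>M\<^esub>" and "x [^] q \<odot>\<^bsub>M\<^esub> m = \<zero>\<^bsub>M\<^esub>"
    and "r \<in> ideal_power R (I <+>\<^bsub>R\<^esub> PIdl x) (p + q)"
  shows "r \<odot>\<^bsub>M\<^esub> m = \<zero>\<^bsub>M\<^esub>"
proof -
  let ?J = "I <+>\<^bsub>R\<^esub> PIdl x"
  have J: "ideal ?J R" by (intro R.add_ideals I R.cgenideal_ideal x)
  have "\<forall>r\<in>ideal_power R ?J n. r \<odot>\<^bsub>M\<^esub> m = \<zero>\<^bsub>M\<^esub>"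
    if "n = p + q" "m \<in> carrier M" "\<forall>r\<in>ideal_power R I p. r \<odot>\<^bsub>M\<^esub> m = \<zero>\<^bsub>M\<^esub>"
      "x [^] q \<odot>\<^bsub>M\<^esub> m = \<zero>\<^bsub>M\<^esub>" for n p q m
    using that
  proof (induction n arbitrary: p q m)
    case 0
    then show ?case by simp
  next
    case (Suc n)
    show ?case
    proof (cases "m = \<zero>\<^bsub>M\<^esub>")
      case True
      then show ?thesis using ideal.Icarr[OF R.ideal_power_ideal[OF J]] smult_r_null by blast
    next
      case False
      have "p \<noteq> 0"
        using Suc.prems(2,3) False by (metis R.one_closed ideal_power.simps(1) smult_one)
      then obtain p' where p: "p = Suc p'" by (cases p) auto
      have "q \<noteq> 0"
        using Suc.prems(2,4) False by (metis R.nat_pow_0 smult_one)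
      then obtain q' where q: "q = Suc q'" by (cases q) auto
      show ?thesis
      proof
        fix r assume "r \<in> ideal_power R ?J (Suc n)"
        then have r: "r \<in> ?J \<cdot> ideal_power R ?J n" by simp
        show "r \<odot>\<^bsub>M\<^esub> m = \<zero>\<^bsub>M\<^esub>"
        proof (rule ideal_prod_annihilates[OF J R.ideal_power_ideal[OF J] Suc.prems(2) _ r])
          fix i j assume "i \<in> ?J" and j: "j \<in> ideal_power R ?J n"
          then obtain u c where u: "u \<in> I" "c \<in> carrier R" "i = u \<oplus> c \<otimes> x"
            unfolding set_add_def' cgenideal_def by blast
          have uc: "u \<in> carrier R" and jc: "j \<in> carrier R"
            using ideal.Icarr[OF I u(1)] ideal.Icarr[OF R.ideal_power_ideal[OF J] j] by auto
          note mc = Suc.prems(2)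
          have "j \<odot>\<^bsub>M\<^esub> (u \<odot>\<^bsub>M\<^esub> m) = \<zero>\<^bsub>M\<^esub>"
          proof (rule bspec[OF Suc.IH[of p' q] j])
            show "\<forall>r\<in>ideal_power R I p'. r \<odot>\<^bsub>M\<^esub> (u \<odot>\<^bsub>M\<^esub> m) = \<zero>\<^bsub>M\<^esub>"
            proof
              fix r assume r: "r \<in> ideal_power R I p'"
              then have "r \<in> carrier R" using ideal.Icarr[OF R.ideal_power_ideal[OF I]] by blast
              then show "r \<odot>\<^bsub>M\<^esub> (u \<odot>\<^bsub>M\<^esub> m) = \<zero>\<^bsub>M\<^esub>"
                using Suc.prems(3) ideal_prod.prod[OF u(1) r, of R] uc mc
                by (simp add: p R.m_comm[of u r] smult_assoc1[symmetric])
            qed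
            show "x [^] q \<odot>\<^bsub>M\<^esub> (u \<odot>\<^bsub>M\<^esub> m) = \<zero>\<^bsub>M\<^esub>"
              using smult_commute[of "x [^] q" u m] Suc.prems(4) x uc mc by simp
          qed (use Suc.prems(1,2) p uc in simp_all)
          moreover have "j \<odot>\<^bsub>M\<^esub> (x \<odot>\<^bsub>M\<^esub> m) = \<zero>\<^bsub>M\<^esub>"
          proof (rule bspec[OF Suc.IH[of p q'] j])
            show "\<forall>r\<in>ideal_power R I p. r \<odot>\<^bsub>M\<^esub> (x \<odot>\<^bsub>M\<^esub> m) = \<zero>\<^bsub>M\<^esub>"
              using Suc.prems(3) smult_commute[OF _ x mc] ideal.Icarr[OF R.ideal_power_ideal[OF I]]
                smult_r_null[OF x]
              by metis
            show "x [^] q' \<odot>\<^bsub>M\<^esub> (x \<odot>\<^bsub>M\<^esub> m) = \<zero>\<^bsub>M\<^esub>"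
              using Suc.prems(4) x mc by (simp add: q smult_assoc1[symmetric])
          qed (use Suc.prems(1,2) q x in simp_all)
          ultimately show "j \<odot>\<^bsub>M\<^esub> (i \<odot>\<^bsub>M\<^esub> m) = \<zero>\<^bsub>M\<^esub>"
            using u(2,3) uc jc x mc smult_commute[OF jc u(2), of "x \<odot>\<^bsub>M\<^esub> m"]
            by (simp add: smult_l_distr smult_r_distr smult_assoc1)
        qed
      qed
    qed
  qed
  from this[OF refl m, of p q] assms show ?thesis by blast
qed


context module
begin

lemma smult_coset:
  assumes N: "submodule N R M" and r: "r \<in> carrier R" and m: "m \<in> carrier M"
  shows "r \<odot>\<^bsub>quotient_module M N\<^esub> (N +>\<^bsub>M\<^esub> m) = N +>\<^bsub>M\<^esub> (r \<odot>\<^bsub>M\<^esub> m)"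
proof -
  interpret N: abelian_subgroup N M
    using submodule.axioms(1)[OF N] M.abelian_group_axioms
    by (intro abelian_subgroupI3 additive_subgroup.intro)
  have "N +>\<^bsub>M\<^esub> (r \<odot>\<^bsub>M\<^esub> m') = N +>\<^bsub>M\<^esub> (r \<odot>\<^bsub>M\<^esub> m)" if m': "m' \<in> N +>\<^bsub>M\<^esub> m" for m'
  proof -
    obtain h where h: "h \<in> N" "m' = h \<oplus>\<^bsub>M\<^esub> m" using m' unfolding a_r_coset_def' by blast
    then have "r \<odot>\<^bsub>M\<^esub> m' = r \<odot>\<^bsub>M\<^esub> h \<oplus>\<^bsub>M\<^esub> r \<odot>\<^bsub>M\<^esub> m"
      using r m N.a_subset by (simp add: smult_r_distr subset_iff)
    moreover have "r \<odot>\<^bsub>M\<^esub> h \<in> N" using submoduleE(4)[OF N r h(1)] .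
    ultimately have "r \<odot>\<^bsub>M\<^esub> m' \<in> N +>\<^bsub>M\<^esub> (r \<odot>\<^bsub>M\<^esub> m)" unfolding a_r_coset_def' by blast
    then show ?thesis using N.a_repr_independence'[of "r \<odot>\<^bsub>M\<^esub> m'" "r \<odot>\<^bsub>M\<^esub> m"] r m by simp
  qed
  moreover have "N +>\<^bsub>M\<^esub> m \<noteq> {}" using N.a_rcos_self[OF m] by blast
  ultimately show ?thesis unfolding quotient_module_def by (simp add: SUP_eq_const)
qed

lemma coset_eq_zero_iff:
  assumes N: "submodule N R M" and m: "m \<in> carrier M"
  shows "N +>\<^bsub>M\<^esub> m = \<zero>\<^bsub>quotient_module M N\<^esub> \<longleftrightarrow> m \<in> N"
proof -
  interpret N: abelian_subgroup N M
    using submodule.axioms(1)[OF N] M.abelian_group_axioms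
    by (intro abelian_subgroupI3 additive_subgroup.intro)
  show ?thesis
    using N.a_rcos_self[OF m] N.a_rcos_const by (auto simp: quotient_module_def)
qed

lemma carrier_quotient_module:
  "carrier (quotient_module M N) = (\<lambda>m. N +>\<^bsub>M\<^esub> m) ` carrier M"
  by (auto simp: quotient_module_def A_RCOSETS_def')

lemma quotient_module_is_module:
  assumes N: "submodule N R M"
  shows "module R (quotient_module M N)"
proof -
  interpret N: abelian_subgroup N M
    using submodule.axioms(1)[OF N] M.abelian_group_axioms
    by (intro abelian_subgroupI3 additive_subgroup.intro)
  let ?Q = "quotient_module M N"
  have add: "(N +>\<^bsub>M\<^esub> a) \<oplus>\<^bsub>?Q\<^esub> (N +>\<^bsub>M\<^esub> b) = N +>\<^bsub>M\<^esub> (a \<oplus>\<^bsub>M\<^esub> b)"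
    if "a \<in> carrier M" "b \<in> carrier M" for a b
    using N.a_rcos_sum[OF that] by (simp add: quotient_module_def)
  have zero: "\<zero>\<^bsub>?Q\<^esub> = N +>\<^bsub>M\<^esub> \<zero>\<^bsub>M\<^esub>"
    using coset_eq_zero_iff[OF N M.zero_closed] N.zero_closed by simp
  have ab: "abelian_group ?Q"
  proof (rule abelian_groupI)
    fix a assume "a \<in> carrier ?Q"
    then obtain m where m: "m \<in> carrier M" "a = N +>\<^bsub>M\<^esub> m" unfolding carrier_quotient_module by blast
    then show "\<exists>b\<in>carrier ?Q. b \<oplus>\<^bsub>?Q\<^esub> a = \<zero>\<^bsub>?Q\<^esub>"
      by (intro bexI[of _ "N +>\<^bsub>M\<^esub> (\<ominus>\<^bsub>M\<^esub> m)"])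
        (auto simp: carrier_quotient_module add zero M.l_neg)
  qed (auto simp: carrier_quotient_module add zero M.a_ac)
  show ?thesis
    by (rule moduleI[OF R.is_cring ab])
      (auto simp: carrier_quotient_module smult_coset[OF N] add
        smult_l_distr smult_r_distr smult_assoc1)
qed

text \<open>If no element outside \<open>P\<close> kills \<open>m\<close>, then the fraction \<open>m/1\<close> is non-zero in the localization at \<open>P\<close>.\<close>

lemma mem_module_supportI:
  assumes P: "primeideal P R" and m: "m \<in> carrier M"
    and nz: "\<And>u. u \<in> carrier R - P \<Longrightarrow> u \<odot>\<^bsub>M\<^esub> m \<noteq> \<zero>\<^bsub>M\<^esub>"
  shows "P \<in> module_support R M"
proof -
  interpret P: primeideal P R by fact
  let ?S = "carrier R - P" and ?F = "fraction_rel R (carrier R - P) M"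
  have one: "\<one> \<in> ?S" using P.I_notcarr P.one_imp_carrier by auto
  have "(m, \<one>) \<in> ?F `` {(m, \<one>)}"
    using m one by (auto simp: fraction_rel_def M.minus_eq M.r_neg intro!: bexI[of _ \<one>])
  moreover have "(m, \<one>) \<notin> localization_zero R ?S M"
  proof
    assume "(m, \<one>) \<in> localization_zero R ?S M"
    then obtain u where u: "u \<in> ?S" "u \<odot>\<^bsub>M\<^esub> (\<one> \<odot>\<^bsub>M\<^esub> \<zero>\<^bsub>M\<^esub> \<ominus>\<^bsub>M\<^esub> \<one> \<odot>\<^bsub>M\<^esub> m) = \<zero>\<^bsub>M\<^esub>"
      unfolding localization_zero_def fraction_rel_def by blast
    then have "\<ominus>\<^bsub>M\<^esub> (u \<odot>\<^bsub>M\<^esub> m) = \<zero>\<^bsub>M\<^esub>"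
      using m by (simp add: M.minus_eq smult_r_minus)
    then have "u \<odot>\<^bsub>M\<^esub> m = \<zero>\<^bsub>M\<^esub>"
      using m u(1) by (simp add: M.add.inv_eq_1_iff)
    with nz[OF u(1)] show False by contradiction
  qed
  moreover have "?F `` {(m, \<one>)} \<in> localization R ?S M"
    unfolding localization_def using m one by (intro quotientI) auto
  ultimately have "localization R ?S M \<noteq> {localization_zero R ?S M}" by auto
  then show ?thesis
    unfolding module_support_def using P by simp
qed

text \<open>For \<open>t\<close> in \<open>Q\<close> but not in \<open>P\<close> the submodules generated by \<open>t\<^sup>i m\<close> descend. If they became
  stationary, \<open>t\<^sup>k (1 - r t)\<close> would kill \<open>m\<close> for some \<open>k\<close> and \<open>r\<close>, hence lie in \<open>P\<close>. As \<open>t\<close> is not in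
  \<open>P\<close>, this puts \<open>1 - r t\<close> into \<open>P\<close> and so into \<open>Q\<close>, which is impossible since \<open>t\<close> is in \<open>Q\<close>.\<close>

lemma not_artinian_if_nonmaximal_prime_in_support:
  assumes P: "primeideal P R" and Q: "primeideal Q R" "P \<subset> Q"
    and m: "m \<in> carrier M" and nz: "\<And>u. u \<in> carrier R - P \<Longrightarrow> u \<odot>\<^bsub>M\<^esub> m \<noteq> \<zero>\<^bsub>M\<^esub>"
  shows "\<not> artinian_module R M"
proof
  assume art: "artinian_module R M"
  obtain t where t: "t \<in> Q" "t \<notin> P" using Q(2) by blast
  have tc: "t \<in> carrier R" using ideal.Icarr[OF primeideal.axioms(1)[OF Q(1)] t(1)] .
  define N where "N i = (\<lambda>r. r \<odot>\<^bsub>M\<^esub> (t [^] i \<odot>\<^bsub>M\<^esub> m)) ` carrier R" for i :: nat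
  have N: "submodule (N i) R M" for i
  proof (rule submodule_criterion)
    show "N i \<subseteq> carrier M" using tc m by (auto simp: N_def)
    show "\<zero>\<^bsub>M\<^esub> \<in> N i" using tc m unfolding N_def
      by (intro image_eqI[of _ _ \<zero>]) auto
    show "a \<oplus>\<^bsub>M\<^esub> b \<in> N i" if ab: "a \<in> N i" "b \<in> N i" for a b
    proof -
      obtain r where r: "a = r \<odot>\<^bsub>M\<^esub> (t [^] i \<odot>\<^bsub>M\<^esub> m)" "r \<in> carrier R"
        using ab(1)[unfolded N_def] by (rule imageE)
      obtain s where s: "b = s \<odot>\<^bsub>M\<^esub> (t [^] i \<odot>\<^bsub>M\<^esub> m)" "s \<in> carrier R"
        using ab(2)[unfolded N_def] by (rule imageE)
      show ?thesis using r s tc m unfolding N_def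
        by (intro image_eqI[of _ _ "r \<oplus> s"]) (auto simp: smult_l_distr)
    qed
    show "s \<odot>\<^bsub>M\<^esub> a \<in> N i" if sa: "s \<in> carrier R" "a \<in> N i" for s a
    proof -
      obtain r where "a = r \<odot>\<^bsub>M\<^esub> (t [^] i \<odot>\<^bsub>M\<^esub> m)" "r \<in> carrier R"
        using sa(2)[unfolded N_def] by (rule imageE)
      then show ?thesis using sa(1) tc m unfolding N_def
        by (intro image_eqI[of _ _ "s \<otimes> r"]) (auto simp: smult_assoc1)
    qed
  qed
  have dec: "N (Suc i) \<subseteq> N i" for i
  proof
    fix a assume "a \<in> N (Suc i)"
    then have "a \<in> (\<lambda>r. r \<odot>\<^bsub>M\<^esub> (t [^] Suc i \<odot>\<^bsub>M\<^esub> m)) ` carrier R" unfolding N_def .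
    then obtain r where r: "a = r \<odot>\<^bsub>M\<^esub> (t [^] Suc i \<odot>\<^bsub>M\<^esub> m)" "r \<in> carrier R"
      by (rule imageE)
    have "t [^] Suc i \<odot>\<^bsub>M\<^esub> m = t \<odot>\<^bsub>M\<^esub> (t [^] i \<odot>\<^bsub>M\<^esub> m)"
      using smult_pow_add[OF tc m, of 1 i] tc by simp
    then have "a = (r \<otimes> t) \<odot>\<^bsub>M\<^esub> (t [^] i \<odot>\<^bsub>M\<^esub> m)"
      using r tc m by (simp add: smult_assoc1)
    then show "a \<in> N i" unfolding N_def using r(2) tc by (intro image_eqI[of _ _ "r \<otimes> t"]) auto
  qed
  have "\<exists>k. \<forall>i\<ge>k. N i = N k"
    using art N dec unfolding artinian_module_def by simp
  then obtain k where k: "\<forall>i\<ge>k. N i = N k" by (rule exE)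
  have "N (Suc k) = N k" by (rule k[rule_format]) simp
  moreover have "t [^] k \<odot>\<^bsub>M\<^esub> m \<in> N k" unfolding N_def using tc m
    by (intro image_eqI[of _ _ \<one>]) auto
  ultimately have "t [^] k \<odot>\<^bsub>M\<^esub> m \<in> (\<lambda>r. r \<odot>\<^bsub>M\<^esub> (t [^] Suc k \<odot>\<^bsub>M\<^esub> m)) ` carrier R"
    unfolding N_def by simp
  then obtain r where r: "t [^] k \<odot>\<^bsub>M\<^esub> m = r \<odot>\<^bsub>M\<^esub> (t [^] Suc k \<odot>\<^bsub>M\<^esub> m)"
    "r \<in> carrier R" by (rule imageE)
  interpret P: primeideal P R by fact
  interpret Q: primeideal Q R by fact
  define u where "u = t [^] k \<otimes> (\<one> \<ominus> r \<otimes> t)"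
  have uc: "u \<in> carrier R" unfolding u_def using tc r(2) by simp
  have u_eq: "u = t [^] k \<oplus> \<ominus> (r \<otimes> t [^] Suc k)"
    unfolding u_def using tc r(2) by (simp add: R.minus_eq R.r_distr R.r_minus R.m_ac)
  have "u \<odot>\<^bsub>M\<^esub> m = t [^] k \<odot>\<^bsub>M\<^esub> m \<oplus>\<^bsub>M\<^esub> \<ominus>\<^bsub>M\<^esub> (r \<odot>\<^bsub>M\<^esub> (t [^] Suc k \<odot>\<^bsub>M\<^esub> m))"
    unfolding u_eq using tc r(2) m
    by (simp add: smult_l_distr smult_l_minus smult_assoc1 del: R.nat_pow_Suc)
  also have "\<dots> = \<zero>\<^bsub>M\<^esub>" unfolding r(1)[symmetric] using tc m by (simp add: M.r_neg)
  finally have "u \<in> P" using nz uc by blast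
  have tP: "t [^] j \<notin> P" for j :: nat
  proof (induction j)
    case 0
    then show ?case using P.I_notcarr P.one_imp_carrier by auto
  next
    case (Suc j)
    then show ?case using P.I_prime[of "t [^] j" t] t(2) tc by auto
  qed
  have "\<one> \<ominus> r \<otimes> t \<in> P"
    using P.I_prime[of "t [^] k" "\<one> \<ominus> r \<otimes> t"] tP[of k] tc r(2) \<open>u \<in> P\<close> unfolding u_def by auto
  then have 1: "\<one> \<ominus> r \<otimes> t \<in> Q" using Q(2) by blast
  have 2: "r \<otimes> t \<in> Q" using Q.I_l_closed[OF t(1) r(2)] .
  have "(\<one> \<ominus> r \<otimes> t) \<oplus> r \<otimes> t = \<one>"
    using tc r(2) by (simp add: R.minus_eq R.a_assoc R.l_neg)
  then have "\<one> \<in> Q" using Q.a_closed[OF 1 2] by simp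
  then show False using Q.one_imp_carrier Q.I_notcarr by auto
qed

end


section \<open>Torsion submodules\<close>

context module
begin

lemma mem_torsion_iff:
  "m \<in> carrier (torsion_functor R I M) \<longleftrightarrow>
    m \<in> carrier M \<and> (\<exists>k. \<forall>r\<in>ideal_power R I k. r \<odot>\<^bsub>M\<^esub> m = \<zero>\<^bsub>M\<^esub>)"
  by (simp add: torsion_functor_def)

lemma torsion_submodule:
  assumes I: "ideal I R"
  shows "submodule (carrier (torsion_functor R I M)) R M"
proof (rule submodule_criterion)
  have Ic: "r \<in> carrier R" if "r \<in> ideal_power R I k" for r k
    using ideal.Icarr[OF R.ideal_power_ideal[OF I] that] .
  show "carrier (torsion_functor R I M) \<subseteq> carrier M"
    by (auto simp: mem_torsion_iff)
  show "\<zero>\<^bsub>M\<^esub> \<in> carrier (torsion_functor R I M)"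
    using Ic by (auto simp: mem_torsion_iff)
  show "a \<oplus>\<^bsub>M\<^esub> b \<in> carrier (torsion_functor R I M)"
    if ab: "a \<in> carrier (torsion_functor R I M)" "b \<in> carrier (torsion_functor R I M)" for a b
  proof -
    have c: "a \<in> carrier M" "b \<in> carrier M" using ab by (auto simp: mem_torsion_iff)
    obtain k where k: "\<forall>r\<in>ideal_power R I k. r \<odot>\<^bsub>M\<^esub> a = \<zero>\<^bsub>M\<^esub>"
      using ab(1) by (auto simp: mem_torsion_iff)
    obtain l where l: "\<forall>r\<in>ideal_power R I l. r \<odot>\<^bsub>M\<^esub> b = \<zero>\<^bsub>M\<^esub>"
      using ab(2) by (auto simp: mem_torsion_iff)
    have "r \<odot>\<^bsub>M\<^esub> (a \<oplus>\<^bsub>M\<^esub> b) = \<zero>\<^bsub>M\<^esub>" if r: "r \<in> ideal_power R I (max k l)" for r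
    proof -
      have "r \<in> ideal_power R I k" "r \<in> ideal_power R I l"
        using r R.ideal_power_decreasing[OF I, of k "max k l"]
          R.ideal_power_decreasing[OF I, of l "max k l"] by auto
      then show ?thesis using k l Ic[OF r] c by (simp add: smult_r_distr)
    qed
    then show ?thesis unfolding mem_torsion_iff using c by auto
  qed
  show "s \<odot>\<^bsub>M\<^esub> a \<in> carrier (torsion_functor R I M)"
    if s: "s \<in> carrier R" and a: "a \<in> carrier (torsion_functor R I M)" for s a
  proof -
    have c: "a \<in> carrier M" using a by (auto simp: mem_torsion_iff)
    obtain k where k: "\<forall>r\<in>ideal_power R I k. r \<odot>\<^bsub>M\<^esub> a = \<zero>\<^bsub>M\<^esub>"
      using a by (auto simp: mem_torsion_iff)
    have "r \<odot>\<^bsub>M\<^esub> (s \<odot>\<^bsub>M\<^esub> a) = \<zero>\<^bsub>M\<^esub>" if r: "r \<in> ideal_power R I k" for r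
      using k r smult_commute[OF Ic[OF r] s c] s by simp
    then show ?thesis unfolding mem_torsion_iff using c s by auto
  qed
qed

lemma mem_torsion_adjoin_iff:
  assumes I: "ideal I R" and x: "x \<in> carrier R"
  shows "m \<in> carrier (torsion_functor R (I <+>\<^bsub>R\<^esub> PIdl x) M) \<longleftrightarrow>
    m \<in> carrier (torsion_functor R I M) \<and> (\<exists>k :: nat. x [^] k \<odot>\<^bsub>M\<^esub> m = \<zero>\<^bsub>M\<^esub>)"
proof
  let ?J = "I <+>\<^bsub>R\<^esub> PIdl x"
  have Px: "ideal (PIdl x) R" by (rule R.cgenideal_ideal[OF x])
  have J: "ideal ?J R" by (rule R.add_ideals[OF I Px])
  note sub = R.ideal_sum_upper[OF I Px]
  have xJ: "x \<in> ?J" using sub R.cgenideal_self[OF x] by blast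
  {
    assume m: "m \<in> carrier (torsion_functor R ?J M)"
    then obtain k where k: "\<forall>r\<in>ideal_power R ?J k. r \<odot>\<^bsub>M\<^esub> m = \<zero>\<^bsub>M\<^esub>"
      by (auto simp: mem_torsion_iff)
    have "ideal_power R I k \<subseteq> ideal_power R ?J k"
      by (rule ideal_power_mono) (use sub in blast)
    then have "\<forall>r\<in>ideal_power R I k. r \<odot>\<^bsub>M\<^esub> m = \<zero>\<^bsub>M\<^esub>" using k by auto
    moreover have "x [^] k \<odot>\<^bsub>M\<^esub> m = \<zero>\<^bsub>M\<^esub>"
      using k R.pow_mem_ideal_power[OF J xJ] by blast
    ultimately show "m \<in> carrier (torsion_functor R I M) \<and> (\<exists>k :: nat. x [^] k \<odot>\<^bsub>M\<^esub> m = \<zero>\<^bsub>M\<^esub>)"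
      using m by (auto simp: mem_torsion_iff)
  next
    assume m: "m \<in> carrier (torsion_functor R I M) \<and> (\<exists>k :: nat. x [^] k \<odot>\<^bsub>M\<^esub> m = \<zero>\<^bsub>M\<^esub>)"
    then obtain p where p: "\<forall>r\<in>ideal_power R I p. r \<odot>\<^bsub>M\<^esub> m = \<zero>\<^bsub>M\<^esub>"
      by (auto simp: mem_torsion_iff)
    obtain q :: nat where q: "x [^] q \<odot>\<^bsub>M\<^esub> m = \<zero>\<^bsub>M\<^esub>" using m by blast
    have mc: "m \<in> carrier M" using m by (simp add: mem_torsion_iff)
    have "\<forall>r\<in>ideal_power R ?J (p + q). r \<odot>\<^bsub>M\<^esub> m = \<zero>\<^bsub>M\<^esub>"
      using adjoin_ideal_power_annihilates[OF I x mc _ q] p by blast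
    then show "m \<in> carrier (torsion_functor R ?J M)"
      using mc by (auto simp: mem_torsion_iff)
  }
qed

end

text \<open>This says that the \<open>I\<close>-torsion of an injective module maps onto its localization at \<open>x\<close>:
  \<open>f / x\<^sup>n\<close> is the image of \<open>g\<close>. Let \<open>I\<^sup>t\<close> kill \<open>f\<close>. The colon ideals \<open>(I\<^sup>t : x\<^sup>k)\<close> increase with \<open>k\<close>;
  if they are stationary from \<open>l\<close> on, the rule that sends \<open>x\<^bsup>l+n\<^esup> r + c\<close> to \<open>x\<^sup>l r f\<close>, for \<open>c\<close> in \<open>I\<^sup>t\<close>,
  is a well-defined map on the ideal \<open>x\<^bsup>l+n\<^esup> R + I\<^sup>t\<close>. By injectivity it extends to \<open>R\<close>, and \<open>g\<close> is the
  image of \<open>1\<close>. The summand \<open>I\<^sup>t\<close>, on which the map is zero, makes \<open>g\<close> a torsion element.\<close>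

lemma injective_torsion_divisible:
  fixes R (structure) and n :: nat
  assumes cring: "cring R" and noeth: "noetherian_ring R" and E: "injective_module R E"
    and I: "ideal I R" and x: "x \<in> carrier R" and f: "f \<in> carrier (torsion_functor R I E)"
  obtains l :: nat and g where "g \<in> carrier (torsion_functor R I E)"
    "x [^] l \<odot>\<^bsub>E\<^esub> f = x [^] (l + n) \<odot>\<^bsub>E\<^esub> g"
proof -
  have mE: "module R E" using E unfolding injective_module_def by (rule conjunct1)
  interpret E: module R E by (rule mE)
  have fc: "f \<in> carrier E" using f by (simp add: E.mem_torsion_iff)
  obtain t where t: "\<forall>r\<in>ideal_power R I t. r \<odot>\<^bsub>E\<^esub> f = \<zero>\<^bsub>E\<^esub>"
    using f by (auto simp: E.mem_torsion_iff)
  have It: "ideal (ideal_power R I t) R" by (rule E.R.ideal_power_ideal[OF I])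
  interpret It: ideal "ideal_power R I t" R by (rule It)
  have xk: "x [^] k \<in> carrier R" for k :: nat using x by simp
  define J where "J k = {r \<in> carrier R. x [^] k \<otimes> r \<in> ideal_power R I t}" for k :: nat
  have J_ideal: "ideal (J k) R" for k
    unfolding J_def by (rule It.helper_max_prime[OF cring xk])
  have J_mono: "J k \<subseteq> J (Suc k)" for k
  proof
    fix r assume "r \<in> J k"
    then have r: "r \<in> carrier R" "x [^] k \<otimes> r \<in> ideal_power R I t" unfolding J_def by auto
    have "x [^] Suc k \<otimes> r = x \<otimes> (x [^] k \<otimes> r)" using x r(1) by (simp add: E.R.m_ac)
    also have "\<dots> \<in> ideal_power R I t" by (rule It.I_l_closed[OF r(2) x])
    finally show "r \<in> J (Suc k)" using r(1) unfolding J_def by simp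
  qed
  obtain l where l: "\<And>k. J (l + k) = J l"
    using noetherian_ring.ascending_ideals_stabilize[OF noeth, of J] J_ideal J_mono by blast
  let ?a = "x [^] (l + n)" and ?b = "x [^] l"
  note [simp] = xk[of "l + n"] xk[of l]
  let ?B = "ring_as_module R"
  \<comment> \<open>With an empty domain to extend from, a partial extension is a homomorphism defined on some
    submodule of the ring, given by its graph.\<close>
  let ?A = "?B\<lparr>carrier := {}\<rparr>"
  have mB: "module R ?B" by (rule module_ring_as_module[OF cring])
  have B_simps: "carrier ?B = carrier R" "r \<oplus>\<^bsub>?B\<^esub> s = r \<oplus> s" "r \<odot>\<^bsub>?B\<^esub> s = r \<otimes> s"
    "\<zero>\<^bsub>?B\<^esub> = \<zero>" for r s by (simp_all add: ring_as_module_def)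
  \<comment> \<open>The graph of the map on \<open>x\<^bsup>l+n\<^esup> R + I\<^sup>t\<close>.\<close>
  define G where "G = (\<lambda>(r, c). (?a \<otimes> r \<oplus> c, (?b \<otimes> r) \<odot>\<^bsub>E\<^esub> f)) ` (carrier R \<times> ideal_power R I t)"
  have G_intro: "(p, e) \<in> G" if "r \<in> carrier R" "c \<in> ideal_power R I t" "p = ?a \<otimes> r \<oplus> c"
    "e = (?b \<otimes> r) \<odot>\<^bsub>E\<^esub> f" for p e r c
    unfolding G_def using that by (intro image_eqI[of _ _ "(r, c)"]) auto
  have G_elim: "\<exists>r c. r \<in> carrier R \<and> c \<in> ideal_power R I t \<and> p = ?a \<otimes> r \<oplus> c \<and>
    e = (?b \<otimes> r) \<odot>\<^bsub>E\<^esub> f" if "(p, e) \<in> G" for p e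
    using that unfolding G_def by auto
  have G: "partial_extension R ?A ?B E (\<lambda>r. r) (\<lambda>r. \<zero>\<^bsub>E\<^esub>) G"
    unfolding partial_extension_def B_simps
  proof (intro conjI allI ballI impI)
    show "G \<subseteq> carrier R \<times> carrier E"
      using fc It.Icarr by (auto simp: G_def)
  next
    fix p e p' e' assume "(p, e) \<in> G" "(p', e') \<in> G"
    then obtain r c r' c' where rc: "r \<in> carrier R" "c \<in> ideal_power R I t" "p = ?a \<otimes> r \<oplus> c"
      "e = (?b \<otimes> r) \<odot>\<^bsub>E\<^esub> f" "r' \<in> carrier R" "c' \<in> ideal_power R I t" "p' = ?a \<otimes> r' \<oplus> c'"
      "e' = (?b \<otimes> r') \<odot>\<^bsub>E\<^esub> f" using G_elim by meson
    have cc: "c \<in> carrier R" "c' \<in> carrier R" using rc It.Icarr by auto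
    show "(p \<oplus> p', e \<oplus>\<^bsub>E\<^esub> e') \<in> G"
    proof (rule G_intro)
      show "r \<oplus> r' \<in> carrier R" using rc by simp
      show "c \<oplus> c' \<in> ideal_power R I t" using rc by (simp add: It.a_closed)
      show "p \<oplus> p' = ?a \<otimes> (r \<oplus> r') \<oplus> (c \<oplus> c')"
        unfolding rc(3,7) using rc(1,5) cc by (simp add: E.R.r_distr E.R.a_ac)
      show "e \<oplus>\<^bsub>E\<^esub> e' = (?b \<otimes> (r \<oplus> r')) \<odot>\<^bsub>E\<^esub> f"
        unfolding rc(4,8) using rc(1,5) fc by (simp add: E.R.r_distr E.smult_l_distr)
    qed
  next
    fix s p e assume s: "s \<in> carrier R" and "(p, e) \<in> G"
    then obtain r c where rc: "r \<in> carrier R" "c \<in> ideal_power R I t" "p = ?a \<otimes> r \<oplus> c"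
      "e = (?b \<otimes> r) \<odot>\<^bsub>E\<^esub> f" using G_elim by meson
    have cc: "c \<in> carrier R" using rc It.Icarr by auto
    show "(s \<otimes> p, s \<odot>\<^bsub>E\<^esub> e) \<in> G"
    proof (rule G_intro)
      show "s \<otimes> r \<in> carrier R" using s rc by simp
      show "s \<otimes> c \<in> ideal_power R I t" using It.I_l_closed[OF rc(2) s] .
      show "s \<otimes> p = ?a \<otimes> (s \<otimes> r) \<oplus> s \<otimes> c"
        unfolding rc(3) using rc(1) cc s by (simp add: E.R.r_distr E.R.m_ac)
      show "s \<odot>\<^bsub>E\<^esub> e = (?b \<otimes> (s \<otimes> r)) \<odot>\<^bsub>E\<^esub> f"
        unfolding rc(4) using rc(1) fc s
        by (simp add: E.smult_assoc1[symmetric] E.R.m_ac)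
    qed
  next
    fix e assume "(\<zero>, e) \<in> G"
    then obtain r c where rc: "r \<in> carrier R" "c \<in> ideal_power R I t" "\<zero> = ?a \<otimes> r \<oplus> c"
      "e = (?b \<otimes> r) \<odot>\<^bsub>E\<^esub> f" using G_elim by meson
    have cc: "c \<in> carrier R" using rc It.Icarr by auto
    \<comment> \<open>Well-definedness: this is where the choice of \<open>l\<close> enters.\<close>
    have "?a \<otimes> r = \<ominus> c"
      using rc(1,3) cc by (metis E.R.m_closed E.R.minus_equality xk)
    then have "?a \<otimes> r \<in> ideal_power R I t" using It.a_inv_closed[OF rc(2)] by simp
    then have "r \<in> J (l + n)" using rc(1) unfolding J_def by simp
    then have "r \<in> J l" using l by simp
    then have "?b \<otimes> r \<in> ideal_power R I t" unfolding J_def by simp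
    then show "e = \<zero>\<^bsub>E\<^esub>" using t rc(4) by simp
  qed simp
  obtain G' g where G': "partial_extension R ?A ?B E (\<lambda>r. r) (\<lambda>r. \<zero>\<^bsub>E\<^esub>) G'" "G \<subseteq> G'" "(\<one>, g) \<in> G'"
    using partial_extension_step[OF E mB G, of \<one>] B_simps(1) E.R.one_closed by auto
  note D = partial_extensionD[OF G'(1), unfolded B_simps]
  note uniq = partial_extension_unique[OF mB mE G'(1)]
  have gc: "g \<in> carrier E" using D(2)[OF G'(3)] .
  have gG: "(r, r \<odot>\<^bsub>E\<^esub> g) \<in> G'" if "r \<in> carrier R" for r
    using D(5)[OF that G'(3)] that by simp
  have "(?a, ?b \<odot>\<^bsub>E\<^esub> f) \<in> G"
    by (rule G_intro[OF E.R.one_closed It.zero_closed]) simp_all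
  then have eq: "?b \<odot>\<^bsub>E\<^esub> f = ?a \<odot>\<^bsub>E\<^esub> g"
    using uniq[OF _ gG[of ?a]] G'(2) by auto
  have "c \<odot>\<^bsub>E\<^esub> g = \<zero>\<^bsub>E\<^esub>" if c: "c \<in> ideal_power R I t" for c
  proof -
    have "(c, \<zero>\<^bsub>E\<^esub>) \<in> G"
      by (rule G_intro[OF E.R.zero_closed c]) (use It.Icarr[OF c] fc in simp_all)
    then show ?thesis using uniq[OF gG[OF It.Icarr[OF c]]] G'(2) by auto
  qed
  then have "g \<in> carrier (torsion_functor R I E)"
    using gc by (auto simp: E.mem_torsion_iff)
  then show thesis using eq that by blast
qed


section \<open>Local cohomology and its support\<close>

locale injective_complex = R: cring R + R: noetherian_ring R
  for R :: "('a, 'r) ring_scheme" (structure) +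
  fixes E :: "nat \<Rightarrow> ('a, 'c) module" and d :: "nat \<Rightarrow> 'c \<Rightarrow> 'c"
  assumes injective: "injective_module R (E i)"
    and diff_hom: "d i \<in> mod_hom R (E i) (E (Suc i))"
    and diff_diff: "z \<in> carrier (E i) \<Longrightarrow> d (Suc i) (d i z) = \<zero>\<^bsub>E (Suc (Suc i))\<^esub>"
begin

lemma module_E: "module R (E i)"
  using injective unfolding injective_module_def by blast

sublocale E: module R "E i" for i
  by (rule module_E)

definition torsion :: "'a set \<Rightarrow> nat \<Rightarrow> 'c set"
  where "torsion I i = carrier (torsion_functor R I (E i))"

definition cocycles :: "'a set \<Rightarrow> nat \<Rightarrow> 'c set"
  where "cocycles I i = {z \<in> torsion I i. d i z = \<zero>\<^bsub>E (Suc i)\<^esub>}"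

definition cobounds :: "'a set \<Rightarrow> nat \<Rightarrow> 'c set"
  where "cobounds I i = coboundaries (\<lambda>j. torsion_functor R I (E j)) d i"

lemma cobounds_0: "cobounds I 0 = {\<zero>\<^bsub>E 0\<^esub>}"
  by (simp add: cobounds_def coboundaries_def torsion_functor_def)

lemma cobounds_Suc: "cobounds I (Suc i) = d i ` torsion I i"
  by (simp add: cobounds_def coboundaries_def torsion_def)

lemma mem_torsion_iff:
  "z \<in> torsion I i \<longleftrightarrow>
    z \<in> carrier (E i) \<and> (\<exists>k. \<forall>r\<in>ideal_power R I k. r \<odot>\<^bsub>E i\<^esub> z = \<zero>\<^bsub>E i\<^esub>)"
  unfolding torsion_def by (rule E.mem_torsion_iff)

lemma torsion_carrier: "z \<in> torsion I i \<Longrightarrow> z \<in> carrier (E i)"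
  by (simp add: mem_torsion_iff)

lemma mem_torsion_adjoin_iff:
  assumes "ideal I R" "x \<in> carrier R"
  shows "z \<in> torsion (I <+>\<^bsub>R\<^esub> PIdl x) i \<longleftrightarrow>
    z \<in> torsion I i \<and> (\<exists>k :: nat. x [^] k \<odot>\<^bsub>E i\<^esub> z = \<zero>\<^bsub>E i\<^esub>)"
  unfolding torsion_def by (rule E.mem_torsion_adjoin_iff[OF assms])

lemma submodule_torsion: "ideal I R \<Longrightarrow> submodule (torsion I i) R (E i)"
  unfolding torsion_def by (rule E.torsion_submodule)

lemmas d_closed = mod_homD(1)[OF diff_hom]
  and d_add = mod_homD(2)[OF diff_hom]
  and d_smult = mod_homD(3)[OF diff_hom]

lemma d_zero: "d i \<zero>\<^bsub>E i\<^esub> = \<zero>\<^bsub>E (Suc i)\<^esub>"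
  by (rule mod_hom_zero[OF module_E module_E diff_hom])

lemma zero_mem_submodule:
  assumes "submodule N R (E i)"
  shows "\<zero>\<^bsub>E i\<^esub> \<in> N"
proof -
  interpret N: submodule N R "E i" by fact
  show ?thesis using N.one_closed by simp
qed

lemma d_torsion:
  assumes I: "ideal I R" and z: "z \<in> torsion I i"
  shows "d i z \<in> torsion I (Suc i)"
proof -
  obtain k where k: "\<forall>r\<in>ideal_power R I k. r \<odot>\<^bsub>E i\<^esub> z = \<zero>\<^bsub>E i\<^esub>"
    using z unfolding mem_torsion_iff by blast
  have "r \<odot>\<^bsub>E (Suc i)\<^esub> d i z = \<zero>\<^bsub>E (Suc i)\<^esub>" if r: "r \<in> ideal_power R I k" for r
  proof -
    have rc: "r \<in> carrier R" using ideal.Icarr[OF R.ideal_power_ideal[OF I] r] .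
    have "r \<odot>\<^bsub>E (Suc i)\<^esub> d i z = d i (r \<odot>\<^bsub>E i\<^esub> z)"
      using d_smult[OF rc torsion_carrier[OF z]] by simp
    then show ?thesis using k r d_zero by simp
  qed
  then show ?thesis
    unfolding mem_torsion_iff using d_closed[OF torsion_carrier[OF z]] by blast
qed

lemma submodule_cobounds:
  assumes I: "ideal I R"
  shows "submodule (cobounds I i) R (E i)"
proof (cases i)
  case 0
  show ?thesis unfolding 0 cobounds_0 by (rule E.submodule_criterion) auto
next
  case (Suc j)
  note T = E.submoduleE[OF submodule_torsion[OF I, of j]]
  show ?thesis unfolding Suc cobounds_Suc
  proof (rule E.submodule_criterion)
    show "d j ` torsion I j \<subseteq> carrier (E (Suc j))"
      using d_closed torsion_carrier by blast
    show "\<zero>\<^bsub>E (Suc j)\<^esub> \<in> d j ` torsion I j"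
      using zero_mem_submodule[OF submodule_torsion[OF I]] d_zero[of j] by (metis imageI)
  next
    fix a b assume "a \<in> d j ` torsion I j" "b \<in> d j ` torsion I j"
    then obtain u v where uv: "a = d j u" "u \<in> torsion I j" "b = d j v" "v \<in> torsion I j" by blast
    then have "a \<oplus>\<^bsub>E (Suc j)\<^esub> b = d j (u \<oplus>\<^bsub>E j\<^esub> v)"
      using d_add torsion_carrier by simp
    then show "a \<oplus>\<^bsub>E (Suc j)\<^esub> b \<in> d j ` torsion I j"
      using T(5) uv by simp
  next
    fix r a assume r: "r \<in> carrier R" and "a \<in> d j ` torsion I j"
    then obtain u where u: "a = d j u" "u \<in> torsion I j" by blast
    then have "r \<odot>\<^bsub>E (Suc j)\<^esub> a = d j (r \<odot>\<^bsub>E j\<^esub> u)"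
      using d_smult[OF r] torsion_carrier by simp
    then show "r \<odot>\<^bsub>E (Suc j)\<^esub> a \<in> d j ` torsion I j"
      using T(4)[OF r u(2)] by simp
  qed
qed

lemma submodule_cocycles:
  assumes I: "ideal I R"
  shows "submodule (cocycles I i) R (E i)"
proof (rule E.submodule_criterion)
  note T = E.submoduleE[OF submodule_torsion[OF I, of i]]
  show "cocycles I i \<subseteq> carrier (E i)"
    by (auto simp: cocycles_def torsion_carrier)
  show "\<zero>\<^bsub>E i\<^esub> \<in> cocycles I i"
    using zero_mem_submodule[OF submodule_torsion[OF I]] d_zero by (simp add: cocycles_def)
  show "a \<oplus>\<^bsub>E i\<^esub> b \<in> cocycles I i" if "a \<in> cocycles I i" "b \<in> cocycles I i" for a b
    using that T(5)[of a b] d_add[of a i b] torsion_carrier[of a I i] torsion_carrier[of b I i]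
    by (simp add: cocycles_def)
  show "r \<odot>\<^bsub>E i\<^esub> a \<in> cocycles I i" if "r \<in> carrier R" "a \<in> cocycles I i" for r a
    using that T(4)[of r a] d_smult[of r a i] torsion_carrier[of a I i] by (simp add: cocycles_def)
qed

lemma cocycles_carrier: "z \<in> cocycles I i \<Longrightarrow> z \<in> carrier (E i)"
  using torsion_carrier by (auto simp: cocycles_def)

lemma cobounds_subset_cocycles:
  assumes I: "ideal I R"
  shows "cobounds I i \<subseteq> cocycles I i"
proof (cases i)
  case 0
  then show ?thesis
    using zero_mem_submodule[OF submodule_cocycles[OF I, of 0]] by (simp add: cobounds_0)
next
  case (Suc j)
  then show ?thesis
    using d_torsion[OF I] diff_diff torsion_carrier by (auto simp: cobounds_Suc cocycles_def)
qed

text \<open>The support of the cohomology module in degree \<open>i\<close>, on the level of cocycles: \<open>P\<close> belongs to it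
  iff some class is killed by no element outside \<open>P\<close>, that is, is non-zero in the localization
  at \<open>P\<close>.\<close>

definition cohom_support :: "'a set \<Rightarrow> nat \<Rightarrow> 'a set set"
  where "cohom_support I i = {P. primeideal P R \<and>
    (\<exists>z\<in>cocycles I i. \<forall>s\<in>carrier R - P. s \<odot>\<^bsub>E i\<^esub> z \<notin> cobounds I i)}"

definition vanishes_above :: "'a set \<Rightarrow> nat \<Rightarrow> bool"
  where "vanishes_above I m \<longleftrightarrow> (\<forall>i>m. cocycles I i \<subseteq> cobounds I i)"

lemma cohom_support_upward:
  assumes "P \<in> cohom_support I i" "primeideal Q R" "P \<subseteq> Q"
  shows "Q \<in> cohom_support I i"
  using assms unfolding cohom_support_def by blast

lemma cohom_support_nonempty:
  assumes I: "ideal I R" and z: "z \<in> cocycles I i" "z \<notin> cobounds I i"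
  obtains P where "P \<in> cohom_support I i"
proof -
  let ?A = "{r \<in> carrier R. r \<odot>\<^bsub>E i\<^esub> z \<in> cobounds I i}"
  have A: "ideal ?A R" by (rule E.colon_ideal[OF submodule_cobounds[OF I] cocycles_carrier[OF z(1)]])
  have disj: "?A \<inter> {\<one>} = {}" using z(2) cocycles_carrier[OF z(1)] by simp
  have S: "{\<one>} \<subseteq> carrier R" "\<one> \<in> {\<one>}" "\<And>s t. s \<in> {\<one>} \<Longrightarrow> t \<in> {\<one>} \<Longrightarrow> s \<otimes> t \<in> {\<one>}"
    by simp_all
  obtain P where P: "primeideal P R" "?A \<subseteq> P"
    using R.prime_avoiding_multiplicative_set[OF A S disj] by metis
  then have "P \<in> cohom_support I i"
    unfolding cohom_support_def using z(1) by auto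
  then show thesis by (rule that)
qed

lemma cohom_support_imp_nonvanishing:
  assumes "P \<in> cohom_support I i"
  shows "\<not> cocycles I i \<subseteq> cobounds I i"
proof -
  from assms obtain z where P: "primeideal P R" and z: "z \<in> cocycles I i"
    and nz: "\<forall>s\<in>carrier R - P. s \<odot>\<^bsub>E i\<^esub> z \<notin> cobounds I i"
    unfolding cohom_support_def by blast
  have "\<one> \<notin> P"
    using ideal.one_imp_carrier[OF primeideal.axioms(1)[OF P]] primeideal.I_notcarr[OF P] by auto
  then have "\<one> \<odot>\<^bsub>E i\<^esub> z \<notin> cobounds I i" using nz by simp
  then show ?thesis using z cocycles_carrier[OF z] by auto
qed

text \<open>Lifting \<open>injective_torsion_divisible\<close> along the differential; in degree \<open>0\<close> the only coboundary is
  zero.\<close>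

lemma cobounds_divisible:
  fixes n :: nat
  assumes I: "ideal I R" and x: "x \<in> carrier R" and v: "v \<in> cobounds I i"
  obtains l :: nat and b where "b \<in> cobounds I i"
    "x [^] l \<odot>\<^bsub>E i\<^esub> v = x [^] (l + n) \<odot>\<^bsub>E i\<^esub> b"
proof (cases i)
  case 0
  then have "v = \<zero>\<^bsub>E i\<^esub>" using v by (simp add: cobounds_0)
  then show thesis using that[OF v, of 0] x by simp
next
  case (Suc j)
  then obtain u where u: "v = d j u" "u \<in> torsion I j" using v by (auto simp: cobounds_Suc)
  obtain l :: nat and g where g: "g \<in> torsion I j"
    "x [^] l \<odot>\<^bsub>E j\<^esub> u = x [^] (l + n) \<odot>\<^bsub>E j\<^esub> g"
    using injective_torsion_divisible[OF R.is_cring R.noetherian_ring_axioms injective I x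
      u(2)[unfolded torsion_def], of n] unfolding torsion_def by blast
  have xl: "x [^] k \<in> carrier R" for k :: nat using x by simp
  have "x [^] l \<odot>\<^bsub>E i\<^esub> v = d j (x [^] l \<odot>\<^bsub>E j\<^esub> u)"
    unfolding Suc u(1) by (rule d_smult[OF xl torsion_carrier[OF u(2)], symmetric])
  also have "\<dots> = x [^] (l + n) \<odot>\<^bsub>E i\<^esub> d j g"
    unfolding Suc g(2) by (rule d_smult[OF xl torsion_carrier[OF g(1)]])
  finally have eq: "x [^] l \<odot>\<^bsub>E i\<^esub> v = x [^] (l + n) \<odot>\<^bsub>E i\<^esub> d j g" .
  have "d j g \<in> cobounds I i" unfolding Suc cobounds_Suc using g(1) by (rule imageI)
  then show thesis using eq by (rule that)
qed

text \<open>The injectivity of the connecting homomorphism modulo the image of \<open>H\<^sup>i\<^sub>I\<close>: the class of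
  \<open>s \<odot> d y\<close> for the ideal \<open>I + (x)\<close> vanishes if \<open>s \<odot> y\<close> becomes a coboundary after multiplication by
  a power of \<open>x\<close>. By divisibility, subtracting a coboundary \<open>b\<close> from \<open>s \<odot> y\<close> leaves an element killed by
  a power of \<open>x\<close>, which has the same differential as \<open>s \<odot> y\<close>.\<close>

lemma cobound_adjoin:
  fixes n :: nat
  assumes I: "ideal I R" and x: "x \<in> carrier R" and y: "y \<in> torsion I i" and s: "s \<in> carrier R"
    and v: "x [^] n \<odot>\<^bsub>E i\<^esub> (s \<odot>\<^bsub>E i\<^esub> y) \<in> cobounds I i"
  shows "s \<odot>\<^bsub>E (Suc i)\<^esub> d i y \<in> cobounds (I <+>\<^bsub>R\<^esub> PIdl x) (Suc i)"
proof -
  obtain l :: nat and b where b: "b \<in> cobounds I i" and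
    eq: "x [^] l \<odot>\<^bsub>E i\<^esub> (x [^] n \<odot>\<^bsub>E i\<^esub> (s \<odot>\<^bsub>E i\<^esub> y)) = x [^] (l + n) \<odot>\<^bsub>E i\<^esub> b"
    using cobounds_divisible[OF I x v, of n] by blast
  have bZ: "b \<in> cocycles I i" using b cobounds_subset_cocycles[OF I] by blast
  then have bT: "b \<in> torsion I i" and db: "d i b = \<zero>\<^bsub>E (Suc i)\<^esub>" by (auto simp: cocycles_def)
  note T = E.submoduleE[OF submodule_torsion[OF I, of i]]
  have bc: "b \<in> carrier (E i)" and yc: "y \<in> carrier (E i)"
    using bT y torsion_carrier by auto
  have sy: "s \<odot>\<^bsub>E i\<^esub> y \<in> carrier (E i)" using s yc by simp
  have xl: "x [^] k \<in> carrier R" for k :: nat using x by simp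
  define y' where "y' = s \<odot>\<^bsub>E i\<^esub> y \<oplus>\<^bsub>E i\<^esub> \<ominus>\<^bsub>E i\<^esub> b"
  have "x [^] (l + n) \<odot>\<^bsub>E i\<^esub> (s \<odot>\<^bsub>E i\<^esub> y) = x [^] (l + n) \<odot>\<^bsub>E i\<^esub> b"
    using eq E.smult_pow_add[OF x sy, of l n] by simp
  then have "x [^] (l + n) \<odot>\<^bsub>E i\<^esub> y' = \<zero>\<^bsub>E i\<^esub>"
    unfolding y'_def using xl[of "l + n"] sy bc
    by (simp add: E.smult_r_distr E.smult_r_minus E.r_neg)
  moreover have "y' \<in> torsion I i"
    unfolding y'_def using T(3)[OF bT] T(4)[OF s y] by (rule T(5)[rotated])
  ultimately have y': "y' \<in> torsion (I <+>\<^bsub>R\<^esub> PIdl x) i"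
    unfolding mem_torsion_adjoin_iff[OF I x] by blast
  have "\<ominus>\<^bsub>E i\<^esub> b = (\<ominus> \<one>) \<odot>\<^bsub>E i\<^esub> b" using bc by (simp add: E.smult_l_minus)
  then have "d i (\<ominus>\<^bsub>E i\<^esub> b) = \<zero>\<^bsub>E (Suc i)\<^esub>"
    using d_smult[of "\<ominus> \<one>" b i] bc db by simp
  then have "d i y' = s \<odot>\<^bsub>E (Suc i)\<^esub> d i y"
    unfolding y'_def using d_add[OF sy, of "\<ominus>\<^bsub>E i\<^esub> b"] d_smult[OF s yc] bc s d_closed[OF yc] by simp
  then show ?thesis unfolding cobounds_Suc using y' by (metis imageI)
qed

text \<open>Let the class of \<open>z\<close> survive at \<open>P\<close>. Since the cohomology for \<open>I\<close> vanishes in degree \<open>i + 1\<close>,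
  \<open>z = d y\<close> with \<open>y\<close> an \<open>I\<close>-torsion element. If \<open>x\<^sup>k\<close> kills \<open>z\<close>, then \<open>w = x\<^sup>k y\<close> is a cocycle. Its
  annihilator avoids every product \<open>x\<^sup>j s\<close> with \<open>s\<close> outside \<open>P\<close>, because otherwise \<open>s \<odot> z\<close> would be a
  coboundary by \<open>cobound_adjoin\<close>. A prime \<open>Q\<close> that contains the annihilator and avoids these products is
  contained in \<open>P\<close>, does not contain \<open>x\<close>, and lies in the support.\<close>

lemma cohom_support_descend:
  assumes I: "ideal I R" and x: "x \<in> carrier R"
    and van: "cocycles I (Suc i) \<subseteq> cobounds I (Suc i)"
    and P: "P \<in> cohom_support (I <+>\<^bsub>R\<^esub> PIdl x) (Suc i)"
  obtains Q where "Q \<in> cohom_support I i" "Q \<subset> P"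
proof -
  let ?J = "I <+>\<^bsub>R\<^esub> PIdl x"
  have J: "ideal ?J R" by (rule R.add_ideals[OF I R.cgenideal_ideal[OF x]])
  from P obtain z where prime: "primeideal P R" and z: "z \<in> cocycles ?J (Suc i)"
    and nz: "\<forall>s\<in>carrier R - P. s \<odot>\<^bsub>E (Suc i)\<^esub> z \<notin> cobounds ?J (Suc i)"
    unfolding cohom_support_def by blast
  interpret P: primeideal P R by (rule prime)
  have zT: "z \<in> torsion ?J (Suc i)" and dz: "d (Suc i) z = \<zero>\<^bsub>E (Suc (Suc i))\<^esub>"
    using z unfolding cocycles_def by auto
  obtain k :: nat where zI: "z \<in> torsion I (Suc i)"
    and k: "x [^] k \<odot>\<^bsub>E (Suc i)\<^esub> z = \<zero>\<^bsub>E (Suc i)\<^esub>"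
    using zT unfolding mem_torsion_adjoin_iff[OF I x] by blast
  have "z \<in> cocycles I (Suc i)" using zI dz unfolding cocycles_def by simp
  then have "z \<in> d i ` torsion I i" using van unfolding cobounds_Suc by blast
  then obtain y where y: "z = d i y" "y \<in> torsion I i" by (rule imageE)
  have yc: "y \<in> carrier (E i)" using torsion_carrier[OF y(2)] .
  have xk: "x [^] j \<in> carrier R" for j :: nat using x by simp
  define w where "w = x [^] k \<odot>\<^bsub>E i\<^esub> y"
  have wT: "w \<in> torsion I i"
    unfolding w_def by (rule E.submoduleE(4)[OF submodule_torsion[OF I] xk y(2)])
  have "d i w = \<zero>\<^bsub>E (Suc i)\<^esub>"
    unfolding w_def using d_smult[OF xk yc] k y(1) by simp
  then have w: "w \<in> cocycles I i" using wT unfolding cocycles_def by simp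
  have wc: "w \<in> carrier (E i)" using cocycles_carrier[OF w] .
  have one: "\<one> \<in> carrier R - P" using P.one_imp_carrier P.I_notcarr by auto
  define A where "A = {r \<in> carrier R. r \<odot>\<^bsub>E i\<^esub> w \<in> cobounds I i}"
  have A: "ideal A R" unfolding A_def by (rule E.colon_ideal[OF submodule_cobounds[OF I] wc])
  define S where "S = (\<lambda>(j :: nat, s). x [^] j \<otimes> s) ` (UNIV \<times> (carrier R - P))"
  have S_intro: "x [^] j \<otimes> s \<in> S" if "s \<in> carrier R" "s \<notin> P" for j :: nat and s
    unfolding S_def using that by (intro image_eqI[of _ _ "(j, s)"]) auto
  have S_elim: "\<exists>(j :: nat) s. u = x [^] j \<otimes> s \<and> s \<in> carrier R \<and> s \<notin> P" if "u \<in> S" for u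
    using that unfolding S_def by auto
  have S_P: "s \<in> S" if "s \<in> carrier R" "s \<notin> P" for s
    using S_intro[OF that, of 0] that by simp
  have S_x: "x [^] j \<in> S" for j :: nat
    using S_intro[of \<one> j] one xk by simp
  have S: "S \<subseteq> carrier R" "\<one> \<in> S" "\<And>s t. s \<in> S \<Longrightarrow> t \<in> S \<Longrightarrow> s \<otimes> t \<in> S"
  proof -
    show "S \<subseteq> carrier R" using xk unfolding S_def by auto
    show "\<one> \<in> S" using S_P one by simp
    fix u v assume "u \<in> S" "v \<in> S"
    then obtain j s j' s' where uv: "u = x [^] (j :: nat) \<otimes> s" "s \<in> carrier R" "s \<notin> P"
      "v = x [^] (j' :: nat) \<otimes> s'" "s' \<in> carrier R" "s' \<notin> P" using S_elim by meson
    have "u \<otimes> v = x [^] (j + j') \<otimes> (s \<otimes> s')"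
      unfolding uv(1,4) using uv(2,5) xk x by (simp add: R.nat_pow_mult[symmetric] R.m_ac)
    moreover have "s \<otimes> s' \<notin> P" using P.I_prime uv by blast
    ultimately show "u \<otimes> v \<in> S" using S_intro uv(2,5) by simp
  qed
  have disj: "A \<inter> S = {}"
  proof (rule ccontr)
    assume "A \<inter> S \<noteq> {}"
    then obtain u where u: "u \<in> A" "u \<in> S" by blast
    then obtain j s where js: "u = x [^] (j :: nat) \<otimes> s" "s \<in> carrier R" "s \<notin> P"
      using S_elim by blast
    have "u \<odot>\<^bsub>E i\<^esub> w = x [^] (j + k) \<odot>\<^bsub>E i\<^esub> (s \<odot>\<^bsub>E i\<^esub> y)"
      unfolding js(1) w_def using js(2) xk x yc
      by (simp add: E.smult_assoc1[symmetric] R.nat_pow_mult[symmetric] R.m_ac)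
    then have "x [^] (j + k) \<odot>\<^bsub>E i\<^esub> (s \<odot>\<^bsub>E i\<^esub> y) \<in> cobounds I i"
      using u(1) unfolding A_def by simp
    from cobound_adjoin[OF I x y(2) js(2) this] show False
      using nz js(2,3) y(1) by blast
  qed
  obtain Q where Q: "primeideal Q R" "A \<subseteq> Q" "Q \<inter> S = {}"
    by (rule R.prime_avoiding_multiplicative_set[OF A S disj])
  have "Q \<in> cohom_support I i"
    unfolding cohom_support_def
  proof (intro CollectI conjI bexI[OF _ w] ballI)
    show "primeideal Q R" by (rule Q(1))
    show "s \<odot>\<^bsub>E i\<^esub> w \<notin> cobounds I i" if "s \<in> carrier R - Q" for s
      using that Q(2) unfolding A_def by blast
  qed
  moreover have "Q \<subseteq> P"
    using S_P Q(3) ideal.Icarr[OF primeideal.axioms(1)[OF Q(1)]] by blast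
  moreover have "x [^] k \<in> P"
  proof (rule ccontr)
    assume "x [^] k \<notin> P"
    then have "x [^] k \<odot>\<^bsub>E (Suc i)\<^esub> z \<notin> cobounds ?J (Suc i)" using nz xk by blast
    then show False using k zero_mem_submodule[OF submodule_cobounds[OF J, of "Suc i"]] by simp
  qed
  moreover have "x [^] k \<notin> Q" using Q(3) S_x by blast
  ultimately show thesis using that by blast
qed

text \<open>A non-zero class in a degree above \<open>m + 1\<close> has a prime in its support, which would descend to a
  prime in the support one degree lower, still above \<open>m\<close>.\<close>

lemma vanishes_above_adjoin:
  assumes I: "ideal I R" and x: "x \<in> carrier R" and van: "vanishes_above I m"
  shows "vanishes_above (I <+>\<^bsub>R\<^esub> PIdl x) (Suc m)"
  unfolding vanishes_above_def
proof (intro allI impI subsetI)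
  let ?J = "I <+>\<^bsub>R\<^esub> PIdl x"
  have J: "ideal ?J R" by (rule R.add_ideals[OF I R.cgenideal_ideal[OF x]])
  fix i z assume i: "Suc m < i" and z: "z \<in> cocycles ?J i"
  from i obtain j where j: "i = Suc j" "m < j" by (cases i) auto
  show "z \<in> cobounds ?J i"
  proof (rule ccontr)
    assume nz: "z \<notin> cobounds ?J i"
    obtain P where P: "P \<in> cohom_support ?J (Suc j)"
      using cohom_support_nonempty[OF J z nz] unfolding j(1) by blast
    have "cocycles I (Suc j) \<subseteq> cobounds I (Suc j)"
      using van j(2) unfolding vanishes_above_def by simp
    then obtain Q where "Q \<in> cohom_support I j"
      using cohom_support_descend[OF I x _ P] by blast
    then show False
      using cohom_support_imp_nonvanishing van j(2) unfolding vanishes_above_def by blast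
  qed
qed

text \<open>Each of the \<open>n\<close> adjoined elements contributes one strict inclusion. The members of the chain
  found in the intermediate supports move to the support for \<open>J 0\<close> because each of them contains
  \<open>p 0\<close>.\<close>

lemma cohom_support_chain:
  fixes x :: "nat \<Rightarrow> 'a" and J :: "nat \<Rightarrow> 'a set"
  assumes J0: "ideal (J 0) R" and van: "vanishes_above (J 0) c"
    and x: "\<And>j. j < n \<Longrightarrow> x (Suc j) \<in> carrier R"
    and J: "\<And>j. j < n \<Longrightarrow> J (Suc j) = J j <+>\<^bsub>R\<^esub> PIdl (x (Suc j))"
    and P: "P \<in> cohom_support (J n) (c + n)"
  obtains p where "\<And>i. i \<le> n \<Longrightarrow> p i \<in> cohom_support (J 0) c" "\<And>i. i < n \<Longrightarrow> p i \<subset> p (Suc i)"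
proof -
  have ideal_van: "ideal (J j) R \<and> vanishes_above (J j) (c + j)" if "j \<le> n" for j
    using that
  proof (induction j)
    case 0
    then show ?case using J0 van by simp
  next
    case (Suc j)
    then have j: "j < n" "ideal (J j) R" "vanishes_above (J j) (c + j)" by auto
    show ?case
      using R.add_ideals[OF j(2) R.cgenideal_ideal[OF x[OF j(1)]]]
        vanishes_above_adjoin[OF j(2) x[OF j(1)] j(3)] by (simp add: J[OF j(1)])
  qed
  have "\<exists>p. (\<forall>i\<le>j. p i \<in> cohom_support (J 0) c) \<and> (\<forall>i<j. p i \<subset> p (Suc i)) \<and> p j = P"
    if "j \<le> n" "P \<in> cohom_support (J j) (c + j)" for j P
    using that
  proof (induction j arbitrary: P)
    case 0
    then show ?case by (intro exI[of _ "\<lambda>_. P"]) simp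
  next
    case (Suc j)
    then have j: "j < n" "j \<le> n" by auto
    have id: "ideal (J j) R" and "vanishes_above (J j) (c + j)"
      using ideal_van[OF j(2)] by auto
    then have v: "cocycles (J j) (Suc (c + j)) \<subseteq> cobounds (J j) (Suc (c + j))"
      unfolding vanishes_above_def by simp
    obtain Q where Q: "Q \<in> cohom_support (J j) (c + j)" "Q \<subset> P"
      using cohom_support_descend[OF id x[OF j(1)] v] Suc.prems(2) unfolding J[OF j(1)] by auto
    from Suc.IH[OF j(2) Q(1)] obtain p where p: "\<forall>i\<le>j. p i \<in> cohom_support (J 0) c"
      "\<forall>i<j. p i \<subset> p (Suc i)" "p j = Q" by blast
    have "primeideal P R" using Suc.prems(2) unfolding cohom_support_def by blast
    then have P0: "P \<in> cohom_support (J 0) c"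
      using cohom_support_upward[of "p j" "J 0" c P] p Q(2) by auto
    show ?case
    proof (intro exI[of _ "p(Suc j := P)"] conjI allI impI)
      show "(p(Suc j := P)) i \<in> cohom_support (J 0) c" if "i \<le> Suc j" for i
        using that p(1) P0 by auto
      show "(p(Suc j := P)) i \<subset> (p(Suc j := P)) (Suc i)" if "i < Suc j" for i
        using that p(2,3) Q(2) by (cases "i = j") auto
    qed simp
  qed
  from this[OF le_refl P] that show thesis by blast
qed

lemma local_cohomology_eq:
  "local_cohomology R I E d i = quotient_module ((E i)\<lparr>carrier := cocycles I i\<rparr>) (cobounds I i)"
  by (simp add: local_cohomology_def cohomology_def cobounds_def cocycles_def torsion_def
      a_kernel_def' torsion_functor_def)

lemma module_cocycles: "ideal I R \<Longrightarrow> module R ((E i)\<lparr>carrier := cocycles I i\<rparr>)"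
  by (rule submodule.submodule_is_module[OF submodule_cocycles module_E])

lemma submodule_cobounds_cocycles:
  assumes I: "ideal I R"
  shows "submodule (cobounds I i) R ((E i)\<lparr>carrier := cocycles I i\<rparr>)"
proof -
  interpret Z: module R "(E i)\<lparr>carrier := cocycles I i\<rparr>" by (rule module_cocycles[OF I])
  note B = E.submoduleE[OF submodule_cobounds[OF I, of i]]
  show ?thesis
    by (rule Z.submodule_criterion)
      (use cobounds_subset_cocycles[OF I] zero_mem_submodule[OF submodule_cobounds[OF I, of i]] B(4,5)
       in simp_all)
qed

lemma module_local_cohomology: "ideal I R \<Longrightarrow> module R (local_cohomology R I E d i)"
  unfolding local_cohomology_eq
  by (rule module.quotient_module_is_module[OF module_cocycles submodule_cobounds_cocycles])

lemma local_cohomology_trivial_iff: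
  assumes I: "ideal I R"
  shows "carrier (local_cohomology R I E d i) = {\<zero>\<^bsub>local_cohomology R I E d i\<^esub>} \<longleftrightarrow>
    cocycles I i \<subseteq> cobounds I i"
proof -
  let ?Z = "(E i)\<lparr>carrier := cocycles I i\<rparr>"
  interpret Z: module R ?Z by (rule module_cocycles[OF I])
  have zero: "\<zero>\<^bsub>E i\<^esub> \<in> cocycles I i"
    by (rule zero_mem_submodule[OF submodule_cocycles[OF I]])
  show ?thesis
    unfolding local_cohomology_eq Z.carrier_quotient_module
    using Z.coset_eq_zero_iff[OF submodule_cobounds_cocycles[OF I]] zero
    by (auto simp: image_iff set_eq_iff subset_iff)
qed

lemma cohom_support_local_cohomology:
  assumes I: "ideal I R" and P: "P \<in> cohom_support I i"
  obtains h where "h \<in> carrier (local_cohomology R I E d i)"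
    "\<And>u. u \<in> carrier R - P \<Longrightarrow>
      u \<odot>\<^bsub>local_cohomology R I E d i\<^esub> h \<noteq> \<zero>\<^bsub>local_cohomology R I E d i\<^esub>"
proof -
  let ?Z = "(E i)\<lparr>carrier := cocycles I i\<rparr>"
  interpret Z: module R ?Z by (rule module_cocycles[OF I])
  note sub = submodule_cobounds_cocycles[OF I, of i]
  from P obtain z where z: "z \<in> cocycles I i"
    and nz: "\<forall>s\<in>carrier R - P. s \<odot>\<^bsub>E i\<^esub> z \<notin> cobounds I i"
    unfolding cohom_support_def by blast
  have zc: "z \<in> carrier ?Z" using z by simp
  show thesis
  proof (rule that)
    show "cobounds I i +>\<^bsub>?Z\<^esub> z \<in> carrier (local_cohomology R I E d i)"
      unfolding local_cohomology_eq Z.carrier_quotient_module using zc by (rule imageI)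
  next
    fix u assume u: "u \<in> carrier R - P"
    then have uc: "u \<in> carrier R" by blast
    have uz: "u \<odot>\<^bsub>?Z\<^esub> z \<in> carrier ?Z" by (rule Z.smult_closed[OF uc zc])
    have "u \<odot>\<^bsub>?Z\<^esub> z \<notin> cobounds I i" using nz u by simp
    then show "u \<odot>\<^bsub>local_cohomology R I E d i\<^esub> (cobounds I i +>\<^bsub>?Z\<^esub> z)
        \<noteq> \<zero>\<^bsub>local_cohomology R I E d i\<^esub>"
      unfolding local_cohomology_eq Z.smult_coset[OF sub uc zc] Z.coset_eq_zero_iff[OF sub uz] .
  qed
qed

lemma cohom_support_subset_module_support:
  assumes I: "ideal I R"
  shows "cohom_support I i \<subseteq> module_support R (local_cohomology R I E d i)"
proof
  fix P assume P: "P \<in> cohom_support I i"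
  then have prime: "primeideal P R" unfolding cohom_support_def by blast
  show "P \<in> module_support R (local_cohomology R I E d i)"
    by (rule cohom_support_local_cohomology[OF I P])
      (rule module.mem_module_supportI[OF module_local_cohomology[OF I] prime])
qed

end

locale exact_injective_complex = injective_complex +
  assumes exact: "z \<in> carrier (E (Suc i)) \<Longrightarrow> d (Suc i) z = \<zero>\<^bsub>E (Suc (Suc i))\<^esub> \<Longrightarrow>
    z \<in> d i ` carrier (E i)"
begin

text \<open>Every element is torsion for the zero ideal, so the complex in question is \<open>E\<close> itself.\<close>

lemma vanishes_above_zero_ideal: "vanishes_above {\<zero>} 0"
proof -
  have "ideal_power R {\<zero>} 1 = {\<zero>}"
    using R.ideal_prod_zero[OF R.oneideal] R.ideal_prod_commute[OF R.zeroideal R.oneideal] by simp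
  then have T: "torsion {\<zero>} i = carrier (E i)" for i
    by (auto simp: mem_torsion_iff intro!: exI[of _ 1])
  show ?thesis
    unfolding vanishes_above_def
  proof (intro allI impI)
    fix i :: nat assume "0 < i"
    then obtain j where j: "i = Suc j" by (cases i) auto
    show "cocycles {\<zero>} i \<subseteq> cobounds {\<zero>} i"
      unfolding j cobounds_Suc cocycles_def T using exact by blast
  qed
qed

lemma vanishes_above_bounded:
  assumes I: "ideal I R"
  shows "\<exists>m. vanishes_above I m"
proof -
  have "\<exists>m. vanishes_above ({\<zero>} <+>\<^bsub>R\<^esub> Idl A) m" if "finite A" "A \<subseteq> carrier R" for A
    using that
  proof induction
    case empty
    then show ?case
      using vanishes_above_zero_ideal R.ideal_sum_genideal_empty[OF R.zeroideal] by auto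
  next
    case (insert a A)
    then obtain m where m: "vanishes_above ({\<zero>} <+>\<^bsub>R\<^esub> Idl A) m" by auto
    have id: "ideal ({\<zero>} <+>\<^bsub>R\<^esub> Idl A) R"
      by (rule R.add_ideals[OF R.zeroideal R.genideal_ideal]) (use insert.prems in blast)
    have a: "a \<in> carrier R" using insert.prems by blast
    show ?case
      using vanishes_above_adjoin[OF id a m] R.ideal_sum_genideal_insert[OF R.zeroideal _ a, of A]
        insert.prems by auto
  qed
  moreover obtain A where A: "A \<subseteq> carrier R" "finite A" "I = Idl A"
    using R.finetely_gen[OF I] by blast
  moreover have "{\<zero>} <+>\<^bsub>R\<^esub> I = I"
  proof
    have "\<zero> \<in> I" using additive_subgroup.zero_closed[OF ideal.axioms(1)[OF I]] .
    then show "{\<zero>} <+>\<^bsub>R\<^esub> I \<subseteq> I"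
      by (intro R.ideal_sum_least[OF R.zeroideal I I]) auto
  qed (rule R.ideal_sum_upper(2)[OF R.zeroideal I])
  ultimately show ?thesis by metis
qed

lemma cohom_dim_eq: "ideal I R \<Longrightarrow> cohom_dim R I E d = Sup {i. \<not> cocycles I i \<subseteq> cobounds I i}"
  by (simp add: cohom_dim_def local_cohomology_trivial_iff)

text \<open>The supremum that defines \<^const>\<open>cohom_dim\<close> is unspecified on infinite sets of natural numbers;
  finiteness makes it an upper bound, and a maximum when the set is non-empty.\<close>

lemma finite_nonvanishing_degrees:
  assumes "ideal I R"
  shows "finite {i. \<not> cocycles I i \<subseteq> cobounds I i}"
proof -
  obtain m where "vanishes_above I m" using vanishes_above_bounded[OF assms] by blast
  then have "{i. \<not> cocycles I i \<subseteq> cobounds I i} \<subseteq> {..m}"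
    unfolding vanishes_above_def by (auto simp: not_less[symmetric])
  then show ?thesis using finite_subset by blast
qed

lemma vanishes_above_cohom_dim:
  assumes I: "ideal I R"
  shows "vanishes_above I (cohom_dim R I E d)"
  unfolding vanishes_above_def
proof (intro allI impI)
  fix i assume i: "cohom_dim R I E d < i"
  show "cocycles I i \<subseteq> cobounds I i"
  proof (rule ccontr)
    assume "\<not> cocycles I i \<subseteq> cobounds I i"
    then have "i \<le> cohom_dim R I E d"
      unfolding cohom_dim_eq[OF I]
      by (intro cSup_upper) (auto intro: bdd_above_finite finite_nonvanishing_degrees[OF I])
    with i show False by simp
  qed
qed

lemma cohom_dim_attained:
  assumes I: "ideal I R" and pos: "0 < cohom_dim R I E d"
  shows "\<not> cocycles I (cohom_dim R I E d) \<subseteq> cobounds I (cohom_dim R I E d)"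
proof -
  let ?S = "{i. \<not> cocycles I i \<subseteq> cobounds I i}"
  have ne: "?S \<noteq> {}"
  proof
    assume "?S = {}"
    then have "cohom_dim R I E d = 0" unfolding cohom_dim_eq[OF I] by (simp only: Sup_nat_empty)
    then show False using pos by simp
  qed
  have "Max ?S \<in> ?S" by (rule Max_in[OF finite_nonvanishing_degrees[OF I] ne])
  moreover have "cohom_dim R I E d = Max ?S"
    unfolding cohom_dim_eq[OF I] by (rule cSup_eq_Max[OF finite_nonvanishing_degrees[OF I] ne])
  ultimately show ?thesis by simp
qed

end

lemma injective_resolution_imp_exact_injective_complex:
  assumes "cring R" "noetherian_ring R" "injective_resolution R X \<epsilon> E d"
  shows "exact_injective_complex R E d"
proof -
  have hom: "\<forall>i. d i \<in> mod_hom R (E i) (E (Suc i))" and inj: "\<forall>i. injective_module R (E i)"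
    and ker: "\<forall>i. a_kernel (E (Suc i)) (E (Suc (Suc i))) (d (Suc i)) = d i ` carrier (E i)"
    using assms(3) unfolding injective_resolution_def by auto
  have "injective_complex R E d"
  proof (intro injective_complex.intro injective_complex_axioms.intro)
    show "d (Suc i) (d i z) = \<zero>\<^bsub>E (Suc (Suc i))\<^esub>" if "z \<in> carrier (E i)" for z i
      using ker[rule_format, of i] that unfolding a_kernel_def' by blast
  qed (use assms hom inj in auto)
  moreover have "z \<in> d i ` carrier (E i)"
    if "z \<in> carrier (E (Suc i))" "d (Suc i) z = \<zero>\<^bsub>E (Suc (Suc i))\<^esub>" for z i
    using ker[rule_format, of i] that unfolding a_kernel_def' by blast
  ultimately show ?thesis
    by (intro exact_injective_complex.intro exact_injective_complex_axioms.intro)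
qed


section \<open>Dimension of the top local cohomology module\<close>

theorem corollary4p1:
  fixes R :: "('a, 'r) ring_scheme"
    and X :: "('a, 'b, 'm) module_scheme"
    and \<epsilon> :: "'b \<Rightarrow> 'c"
    and E :: "nat \<Rightarrow> ('a, 'c) module"
    and d :: "nat \<Rightarrow> 'c \<Rightarrow> 'c"
    and \<aa> :: "'a set"
    and n :: nat
    and x :: "nat \<Rightarrow> 'a"
  assumes "cring R" and "noetherian_ring R"
    and "ideal \<aa> R" and "\<aa> \<noteq> carrier R"
    and "module R X" and "carrier X \<noteq> {\<zero>\<^bsub>X\<^esub>}"
    and "injective_resolution R X \<epsilon> E d"
    and "n > 0" and "\<And>i. i \<in> {1..n} \<Longrightarrow> x i \<in> carrier R"
    and "cohom_dim R (\<aa> <+>\<^bsub>R\<^esub> Idl\<^bsub>R\<^esub> (x ` {1..n})) E d = cohom_dim R \<aa> E d + n"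
  shows "module_dim R (local_cohomology R \<aa> E d (cohom_dim R \<aa> E d)) \<ge> enat n \<and>
         \<not> artinian_module R (local_cohomology R \<aa> E d (cohom_dim R \<aa> E d))"
proof -
  interpret exact_injective_complex R E d
    by (rule injective_resolution_imp_exact_injective_complex[OF assms(1,2,7)])
  note I = assms(3) and npos = assms(8) and xc = assms(9) and cd = assms(10)
  let ?c = "cohom_dim R \<aa> E d"
  let ?H = "local_cohomology R \<aa> E d ?c"
  define J where "J j = \<aa> <+>\<^bsub>R\<^esub> Idl\<^bsub>R\<^esub> (x ` {1..j})" for j
  have J0: "J 0 = \<aa>" unfolding J_def using R.ideal_sum_genideal_empty[OF I] by simp
  have JS: "J (Suc j) = J j <+>\<^bsub>R\<^esub> PIdl\<^bsub>R\<^esub> (x (Suc j))" if j: "j < n" for j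
  proof -
    have "x ` {1..Suc j} = insert (x (Suc j)) (x ` {1..j})" by (auto simp: atLeastAtMostSuc_conv)
    moreover have "x ` {1..j} \<subseteq> carrier R" "x (Suc j) \<in> carrier R" using j xc by auto
    ultimately show ?thesis
      unfolding J_def using R.ideal_sum_genideal_insert[OF I, of "x ` {1..j}" "x (Suc j)"] by simp
  qed
  have Jn: "ideal (J n) R"
    unfolding J_def by (rule R.add_ideals[OF I R.genideal_ideal]) (use xc in auto)
  have cdn: "cohom_dim R (J n) E d = ?c + n" using cd unfolding J_def .
  then have "\<not> cocycles (J n) (?c + n) \<subseteq> cobounds (J n) (?c + n)"
    using cohom_dim_attained[OF Jn] npos by simp
  then obtain P where P: "P \<in> cohom_support (J n) (?c + n)"
    using cohom_support_nonempty[OF Jn] by blast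
  obtain p where p: "\<And>i. i \<le> n \<Longrightarrow> p i \<in> cohom_support \<aa> ?c" "\<And>i. i < n \<Longrightarrow> p i \<subset> p (Suc i)"
    using cohom_support_chain[of J ?c n x P, unfolded J0] I vanishes_above_cohom_dim[OF I] xc JS P
    by auto
  have "\<forall>i\<le>n. p i \<in> module_support R ?H"
    using p(1) cohom_support_subset_module_support[OF I] by blast
  then have "enat n \<in> {enat l | l. \<exists>p :: nat \<Rightarrow> 'a set.
      (\<forall>i\<le>l. p i \<in> module_support R ?H) \<and> (\<forall>i<l. p i \<subset> p (Suc i))}"
    using p(2) by blast
  then have "enat n \<le> module_dim R ?H"
    unfolding module_dim_def by (rule Sup_upper)
  moreover have "\<not> artinian_module R ?H"
  proof (rule cohom_support_local_cohomology[OF I p(1)[of 0]])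
    show "(0 :: nat) \<le> n" by simp
    fix h assume h: "h \<in> carrier ?H" "\<And>u. u \<in> carrier R - p 0 \<Longrightarrow> u \<odot>\<^bsub>?H\<^esub> h \<noteq> \<zero>\<^bsub>?H\<^esub>"
    have prime: "primeideal (p 0) R" "primeideal (p 1) R"
      using p(1)[of 0] p(1)[of 1] npos unfolding cohom_support_def by auto
    have "p 0 \<subset> p 1" using p(2)[of 0] npos by simp
    then show "\<not> artinian_module R ?H"
      by (rule module.not_artinian_if_nonmaximal_prime_in_support[OF module_local_cohomology[OF I] prime _ h])
  qed
  ultimately show ?thesis by blast
qed

end
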